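(* Suppose the standing assumption in the context holds with a bounded set $\mathcal{X}$, that every limit point of the sequence $\{x_k\}$ satisfies the LICQ (defined in the context), and that the algorithm in the context does not terminate finitely. Then any limit point $x_*$ of the sequence $\{x_k\}_{k\in\mathcal{S}}$ is a first-order KKT point for the problem $\min_{x\in\mathbb{R}^n} f(x)+r(x)$ subject to $c(x)=0$, $x\in\Omega$.
   Context: Problem and notation. Consider $\min_{x\in\mathbb{R}^n} f(x)+r(x)$ subject to $c(x)=0$, $x\in\Omega$, where $f:\mathbb{R}^n\to\mathbb{R}$ and $c:\mathbb{R}^n\to\mathbb{R}^m$ ($m\le n$) are continuously differentiable, $r:\mathbb{R}^n\to[0,\infty)$ is convex (possibly nonsmooth), and $\Omega=\{x\in\mathbb{R}^n: x\ge0\}$. Let $g=\nabla f$ and $J(x)=\nabla c(x)^T\in\mathbb{R}^{m\times n}$ (the Jacobian); $f_k,r_k,g_k,c_k,J_k$ denote values at $x_k$; $\mathbb{N}=\{0,1,2,\dots\}$; minima/maxima of vectors are componentwise; $\mathrm{Proj}_C$ is Euclidean projection onto $C$; $T_\Omega(x)$ is the tangent cone of $\Omega$ at $x$. A point $x$ is a first-order KKT point if there exist $g_r\in\partial r(x)$, $y\in\mathbb{R}^m$, $z\in\mathbb{R}^n$ with $g(x)+g_r+J(x)^Ty+z=0$, $c(x)=0$, $\min\{x,-z\}=0$. Algorithm. Inputs: $x_0\in\Omega$, $\alpha_0,\tau_{-1},\kappa_v>0$, and $\xi,\eta_\Phi,\sigma_c,\epsilon_\tau,\gamma,\eta_m\in(0,1)$.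 For $k=0,1,2,\dots$: (1) Let $\delta_k=\|\mathrm{Proj}_{T_\Omega(x_k)}(-J_k^Tc_k)\|_2$, $m_k(v)=\frac12\|c_k+J_kv\|_2^2$, and $v_k(\beta)=\mathrm{Proj}_\Omega(x_k-\beta J_k^Tc_k)-x_k$ for $\beta>0$. The Cauchy point is $v_k^c=v_k(\beta_k)$ with $\beta_k=\gamma^{i_k}$, where $i_k$ is the smallest nonnegative integer such that $\|v_k(\beta_k)\|_2\le\kappa_v\alpha_k\delta_k$ and $m_k(v_k(\beta_k))\le m_k(0)+\eta_m\nabla m_k(0)^Tv_k(\beta_k)$. (2) If $\delta_k=0$, set $v_k=0$ and, if additionally $c_k\ne0$, terminate returning $x_k$. If $\delta_k\neq0$, let $v_k$ be any vector with $\|v_k\|_2\le\kappa_v\alpha_k\delta_k$, $x_k+v_k\in\Omega$, and $m_k(v_k)\le m_k(v_k^c)$. (3) Let $u_k$ be the unique minimizer of $g_k^Tu+\frac{1}{2\alpha_k}\|u\|_2^2+\frac1{\alpha_k}v_k^Tu+r(x_k+v_k+u)$ over $u\in\mathbb{R}^n$ with $J_ku=0$, $x_k+v_k+u\in\Omega$; set $s_k=v_k+u_k$. (4) If $s_k=0$, terminate returning $x_k$. (5) Let $A_k=g_k^Ts_k+\frac1{2\alpha_k}\|s_k\|_2^2+r(x_k+s_k)-r_k$; $\tau_{k,\mathrm{trial}}=\infty$ if $A_k\le0$ and $\tau_{k,\mathrm{trial}}=(1-\sigma_c)(\|c_k\|_2-\|c_k+J_ks_k\|_2)/A_k$ otherwise;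 $\tau_k=\tau_{k-1}$ if $\tau_{k-1}\le\tau_{k,\mathrm{trial}}$ and $\tau_k=\min\{(1-\epsilon_\tau)\tau_{k-1},\tau_{k,\mathrm{trial}}\}$ otherwise. (6) With $\Phi_\tau(x)=\tau(f(x)+r(x))+\|c(x)\|_2$: if $\Phi_{\tau_k}(x_k+s_k)-\Phi_{\tau_k}(x_k)\le-\eta_\Phi\left(\frac{\tau_k}{4\alpha_k}\|s_k\|_2^2+\sigma_c(\|c_k\|_2-\|c_k+J_ks_k\|_2)\right)$, set $x_{k+1}=x_k+s_k$, $\alpha_{k+1}=\alpha_k$; otherwise set $x_{k+1}=x_k$, $\alpha_{k+1}=\xi\alpha_k$. $\mathcal{S}=\{k\in\mathbb{N}:x_{k+1}=x_k+s_k\}$ is the set of successful iterations. Standing assumption. There is an open convex set $\mathcal{X}\subseteq\mathbb{R}^n$ containing all $x_k$ and $x_k+v_k$ such that, over $\mathcal{X}$, $f$ and each $c_i$ are bounded, $\nabla f$ and each $\nabla c_i$ are Lipschitz continuous and bounded in norm, and $\partial r$ is bounded. LICQ. A point $x_*$ satisfies the LICQ if $[J(x_* )^T,I_{\mathcal{A}(x_* )}^T]^T$ ($J(x_* )$ stacked on $I_{\mathcal{A}(x_* )}$) has full row rank, where $\mathcal{A}(x_* )=\{i:[x_*]_i=0\}$ and $I_{\mathcal{A}(x_* )}$ consists of the rows of the $n\times n$ identity matrix indexed by $\mathcal{A}(x_* )$. *)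

theory Defs
  imports "HOL-Analysis.Analysis"
begin

section \<open>Problem data\<close>

definition gradient :: "('a::real_inner \<Rightarrow> real) \<Rightarrow> 'a \<Rightarrow> 'a" where
  "gradient h x = (THE D. GDERIV h x :> D)"

definition subdifferential :: "('a::real_inner \<Rightarrow> real) \<Rightarrow> 'a \<Rightarrow> 'a set" where
  "subdifferential h x = {w. \<forall>y. h y \<ge> h x + w \<bullet> (y - x)}"

text \<open>The tangent cone in the sense of Bouligand, for a point of an arbitrary set.\<close>
definition tangent_cone :: "'a::real_normed_vector set \<Rightarrow> 'a \<Rightarrow> 'a set" where
  "tangent_cone S x = {d. \<exists>(y :: nat \<Rightarrow> 'a) (t :: nat \<Rightarrow> real).
     (\<forall>j. y j \<in> S) \<and> y \<longlonglongrightarrow> x \<and> (\<forall>j. t j > 0) \<and> t \<longlonglongrightarrow> 0 \<and>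
     (\<lambda>j. (y j - x) /\<^sub>R t j) \<longlonglongrightarrow> d}"

definition Omega :: "(real ^ 'n) set" where
  "Omega = {x. \<forall>i. 0 \<le> x $ i}"

abbreviation Jac :: "(real ^ 'n \<Rightarrow> real ^ 'm) \<Rightarrow> real ^ 'n \<Rightarrow> real ^ 'n ^ 'm" where
  "Jac c x \<equiv> jacobian c (at x)"

definition kkt_point ::
  "(real ^ 'n \<Rightarrow> real) \<Rightarrow> (real ^ 'n \<Rightarrow> real) \<Rightarrow> (real ^ 'n \<Rightarrow> real ^ 'm) \<Rightarrow> real ^ 'n \<Rightarrow> bool" where
  "kkt_point f r c x \<longleftrightarrow>
     (\<exists>gr \<in> subdifferential r x. \<exists>(y :: real ^ 'm) (z :: real ^ 'n).
        gradient f x + gr + transpose (Jac c x) *v y + z = 0 \<and>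
        c x = 0 \<and> (\<forall>i. min (x $ i) (- (z $ i)) = 0))"

definition active_set :: "real ^ 'n \<Rightarrow> 'n set" where
  "active_set x = {i. x $ i = 0}"

text \<open>The matrix with block rows \<open>J(x)\<close> and \<open>I\<^bsub>A(x)\<^esub>\<close>.  Since the number of rows of the second
  block depends on \<open>x\<close>, the rows of the identity with an inactive index are kept as zero rows; these
  do not contribute to the rank, and they are not counted in \<open>licq\<close>.\<close>
definition stacked_matrix :: "(real ^ 'n \<Rightarrow> real ^ 'm) \<Rightarrow> real ^ 'n \<Rightarrow> real ^ 'n ^ ('m + 'n)" where
  "stacked_matrix c x = (\<chi> k. case k of
       Inl j \<Rightarrow> row j (Jac c x)
     | Inr i \<Rightarrow> if i \<in> active_set x then row i (mat 1) else 0)"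

definition licq :: "(real ^ 'n \<Rightarrow> real ^ 'm) \<Rightarrow> real ^ 'n \<Rightarrow> bool" where
  "licq c x \<longleftrightarrow> rank (stacked_matrix c x) = CARD('m) + card (active_set x)"

text \<open>Limit points of the sequence \<open>(X k)\<close> with \<open>k\<close> ranging over \<open>K\<close> are limits of subsequences
  (as opposed to accumulation points of the range).\<close>
definition limit_point_along :: "nat set \<Rightarrow> (nat \<Rightarrow> 'a::topological_space) \<Rightarrow> 'a \<Rightarrow> bool" where
  "limit_point_along K X p \<longleftrightarrow>
     (\<exists>\<phi> :: nat \<Rightarrow> nat. strict_mono \<phi> \<and> range \<phi> \<subseteq> K \<and> (X \<circ> \<phi>) \<longlonglongrightarrow> p)"


section \<open>The algorithm\<close>

record ('n::finite) inputs =
  x_init :: "real ^ 'n"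
  alpha_init :: real
  tau_init :: real  \<comment> \<open>\<open>\<tau>\<close> with index \<open>-1\<close>\<close>
  kappa_v :: real
  xi :: real
  eta_Phi :: real
  sigma_c :: real
  eps_tau :: real
  gam :: real
  eta_m :: real

definition valid_inputs :: "'n::finite inputs \<Rightarrow> bool" where
  "valid_inputs P \<longleftrightarrow>
     x_init P \<in> Omega \<and> alpha_init P > 0 \<and> tau_init P > 0 \<and> kappa_v P > 0 \<and>
     xi P \<in> {0<..<1} \<and> eta_Phi P \<in> {0<..<1} \<and> sigma_c P \<in> {0<..<1} \<and>
     eps_tau P \<in> {0<..<1} \<and> gam P \<in> {0<..<1} \<and> eta_m P \<in> {0<..<1}"

definition delta :: "(real ^ 'n \<Rightarrow> real ^ 'm) \<Rightarrow> real ^ 'n \<Rightarrow> real" where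
  "delta c x = norm (closest_point (tangent_cone Omega x) (- (transpose (Jac c x) *v c x)))"

definition m_model :: "(real ^ 'n \<Rightarrow> real ^ 'm) \<Rightarrow> real ^ 'n \<Rightarrow> real ^ 'n \<Rightarrow> real" where
  "m_model c x v = 1 / 2 * (norm (c x + Jac c x *v v))\<^sup>2"

definition v_proj :: "(real ^ 'n \<Rightarrow> real ^ 'm) \<Rightarrow> real ^ 'n \<Rightarrow> real \<Rightarrow> real ^ 'n" where
  "v_proj c x \<beta> = closest_point Omega (x - \<beta> *\<^sub>R (transpose (Jac c x) *v c x)) - x"

definition cauchy_acceptable ::
  "'n::finite inputs \<Rightarrow> (real ^ 'n \<Rightarrow> real ^ 'm) \<Rightarrow> real ^ 'n \<Rightarrow> real \<Rightarrow> real \<Rightarrow> bool" where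
  "cauchy_acceptable P c x \<alpha> \<beta> \<longleftrightarrow>
     norm (v_proj c x \<beta>) \<le> kappa_v P * \<alpha> * delta c x \<and>
     m_model c x (v_proj c x \<beta>)
       \<le> m_model c x 0 + eta_m P * (gradient (m_model c x) 0 \<bullet> v_proj c x \<beta>)"

definition cauchy_point ::
  "'n::finite inputs \<Rightarrow> (real ^ 'n \<Rightarrow> real ^ 'm) \<Rightarrow> real ^ 'n \<Rightarrow> real \<Rightarrow> real ^ 'n" where
  "cauchy_point P c x \<alpha> = v_proj c x (gam P ^ (LEAST i. cauchy_acceptable P c x \<alpha> (gam P ^ i)))"

definition normal_step ::
  "'n::finite inputs \<Rightarrow> (real ^ 'n \<Rightarrow> real ^ 'm) \<Rightarrow> real ^ 'n \<Rightarrow> real \<Rightarrow> real ^ 'n \<Rightarrow> bool" where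
  "normal_step P c x \<alpha> v \<longleftrightarrow>
     (if delta c x = 0 then v = 0
      else norm v \<le> kappa_v P * \<alpha> * delta c x \<and> x + v \<in> Omega \<and>
           m_model c x v \<le> m_model c x (cauchy_point P c x \<alpha>))"

text \<open>The objective is strongly convex, so there is at most one minimizer \<open>u\<close>.\<close>
definition tangential_step ::
  "(real ^ 'n \<Rightarrow> real) \<Rightarrow> (real ^ 'n \<Rightarrow> real) \<Rightarrow> (real ^ 'n \<Rightarrow> real ^ 'm) \<Rightarrow>
   real ^ 'n \<Rightarrow> real \<Rightarrow> real ^ 'n \<Rightarrow> real ^ 'n \<Rightarrow> bool" where
  "tangential_step f r c x \<alpha> v u \<longleftrightarrow>
     is_arg_min
       (\<lambda>w. gradient f x \<bullet> w + 1 / (2 * \<alpha>) * (norm w)\<^sup>2 + 1 / \<alpha> * (v \<bullet> w) + r (x + v + w))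
       (\<lambda>w. Jac c x *v w = 0 \<and> x + v + w \<in> Omega) u"

definition lin_decrease :: "(real ^ 'n \<Rightarrow> real ^ 'm) \<Rightarrow> real ^ 'n \<Rightarrow> real ^ 'n \<Rightarrow> real" where
  "lin_decrease c x s = norm (c x) - norm (c x + Jac c x *v s)"

definition tau_trial ::
  "'n::finite inputs \<Rightarrow> (real ^ 'n \<Rightarrow> real) \<Rightarrow> (real ^ 'n \<Rightarrow> real) \<Rightarrow> (real ^ 'n \<Rightarrow> real ^ 'm) \<Rightarrow>
   real ^ 'n \<Rightarrow> real \<Rightarrow> real ^ 'n \<Rightarrow> ereal" where
  "tau_trial P f r c x \<alpha> s =
     (let A = gradient f x \<bullet> s + 1 / (2 * \<alpha>) * (norm s)\<^sup>2 + r (x + s) - r x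
      in if A \<le> 0 then \<infinity> else ereal ((1 - sigma_c P) * lin_decrease c x s / A))"

definition tau_update :: "'n::finite inputs \<Rightarrow> real \<Rightarrow> ereal \<Rightarrow> real \<Rightarrow> bool" where
  "tau_update P \<tau>_prev trial \<tau> \<longleftrightarrow>
     ereal \<tau> = (if ereal \<tau>_prev \<le> trial then ereal \<tau>_prev
                else min (ereal ((1 - eps_tau P) * \<tau>_prev)) trial)"

definition merit ::
  "(real ^ 'n \<Rightarrow> real) \<Rightarrow> (real ^ 'n \<Rightarrow> real) \<Rightarrow> (real ^ 'n \<Rightarrow> real ^ 'm) \<Rightarrow>
   real \<Rightarrow> real ^ 'n \<Rightarrow> real" where
  "merit f r c \<tau> x = \<tau> * (f x + r x) + norm (c x)"

definition sufficient_decrease ::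
  "'n::finite inputs \<Rightarrow> (real ^ 'n \<Rightarrow> real) \<Rightarrow> (real ^ 'n \<Rightarrow> real) \<Rightarrow> (real ^ 'n \<Rightarrow> real ^ 'm) \<Rightarrow>
   real ^ 'n \<Rightarrow> real \<Rightarrow> real \<Rightarrow> real ^ 'n \<Rightarrow> bool" where
  "sufficient_decrease P f r c x \<alpha> \<tau> s \<longleftrightarrow>
     merit f r c \<tau> (x + s) - merit f r c \<tau> x
       \<le> - eta_Phi P * (\<tau> / (4 * \<alpha>) * (norm s)\<^sup>2 + sigma_c P * lin_decrease c x s)"

definition stops_infeasible :: "(real ^ 'n \<Rightarrow> real ^ 'm) \<Rightarrow> real ^ 'n \<Rightarrow> bool" where
  "stops_infeasible c x \<longleftrightarrow> delta c x = 0 \<and> c x \<noteq> 0"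

text \<open>Both termination tests: the one after the normal step and \<open>s = v + u = 0\<close>.\<close>
definition terminates_at ::
  "(real ^ 'n \<Rightarrow> real ^ 'm) \<Rightarrow> (nat \<Rightarrow> real ^ 'n) \<Rightarrow> (nat \<Rightarrow> real ^ 'n) \<Rightarrow> (nat \<Rightarrow> real ^ 'n) \<Rightarrow>
   nat \<Rightarrow> bool" where
  "terminates_at c x v u k \<longleftrightarrow> stops_infeasible c (x k) \<or> v k + u k = 0"

text \<open>The sequences \<open>x, v, u, \<alpha>, \<tau>\<close> are produced by an execution of the algorithm.  They are
  unconstrained at quantities that are no longer computed because the algorithm has terminated.\<close>
definition algorithm_run ::
  "'n::finite inputs \<Rightarrow> (real ^ 'n \<Rightarrow> real) \<Rightarrow> (real ^ 'n \<Rightarrow> real) \<Rightarrow> (real ^ 'n \<Rightarrow> real ^ 'm) \<Rightarrow>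
   (nat \<Rightarrow> real ^ 'n) \<Rightarrow> (nat \<Rightarrow> real ^ 'n) \<Rightarrow> (nat \<Rightarrow> real ^ 'n) \<Rightarrow>
   (nat \<Rightarrow> real) \<Rightarrow> (nat \<Rightarrow> real) \<Rightarrow> bool" where
  "algorithm_run P f r c x v u \<alpha> \<tau> \<longleftrightarrow>
     x 0 = x_init P \<and> \<alpha> 0 = alpha_init P \<and>
     (\<forall>k. (\<forall>j<k. \<not> terminates_at c x v u j) \<longrightarrow>
        normal_step P c (x k) (\<alpha> k) (v k) \<and>
        (\<not> stops_infeasible c (x k) \<longrightarrow>
           tangential_step f r c (x k) (\<alpha> k) (v k) (u k) \<and>
           (let s = v k + u k in s \<noteq> 0 \<longrightarrow>
              tau_update P (if k = 0 then tau_init P else \<tau> (k - 1))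
                (tau_trial P f r c (x k) (\<alpha> k) s) (\<tau> k) \<and>
              (if sufficient_decrease P f r c (x k) (\<alpha> k) (\<tau> k) s
               then x (Suc k) = x k + s \<and> \<alpha> (Suc k) = \<alpha> k
               else x (Suc k) = x k \<and> \<alpha> (Suc k) = xi P * \<alpha> k))))"

definition successful :: "(nat \<Rightarrow> real ^ 'n) \<Rightarrow> (nat \<Rightarrow> real ^ 'n) \<Rightarrow> (nat \<Rightarrow> real ^ 'n) \<Rightarrow> nat set" where
  "successful x v u = {k. x (Suc k) = x k + (v k + u k)}"

definition standing_assumption ::
  "(real ^ 'n \<Rightarrow> real) \<Rightarrow> (real ^ 'n \<Rightarrow> real) \<Rightarrow> (real ^ 'n \<Rightarrow> real ^ 'm) \<Rightarrow>
   (nat \<Rightarrow> real ^ 'n) \<Rightarrow> (nat \<Rightarrow> real ^ 'n) \<Rightarrow> (real ^ 'n) set \<Rightarrow> bool" where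
  "standing_assumption f r c x v X \<longleftrightarrow>
     open X \<and> convex X \<and> (\<forall>k. x k \<in> X \<and> x k + v k \<in> X) \<and>
     bounded (f ` X) \<and>
     (\<exists>L. L-lipschitz_on X (gradient f)) \<and> bounded (gradient f ` X) \<and>
     (\<forall>i. bounded ((\<lambda>p. c p $ i) ` X) \<and>
          (\<exists>L. L-lipschitz_on X (gradient (\<lambda>p. c p $ i))) \<and>
          bounded (gradient (\<lambda>p. c p $ i) ` X)) \<and>
     bounded (\<Union>p\<in>X. subdifferential r p)"

end

theory Submission
  imports Defs
begin

text \<open>The step \<open>s = v + u\<close> minimizes \<open>g \<bullet> s + \<parallel>s\<parallel>\<^sup>2 / (2\<alpha>) + r (x + s)\<close> among the feasible steps with the
  same linearized constraint value as \<open>v\<close>.  Near a point satisfying LICQ, projected gradient steps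
  move the inactive coordinates freely, so the normal step decreases the linearized constraint
  violation by at least a multiple of \<open>\<alpha> \<parallel>c\<parallel>\<close>.  This bounds the trial values of \<open>\<tau>\<close> away from zero,
  hence \<open>\<tau>\<close> is eventually constant, and it shows that \<open>\<parallel>s\<parallel> / \<alpha> \<rightarrow> 0\<close> along iterates converging to a point
  forces that point to be feasible and stationary.  So near a limit point \<open>x\<^sub>*\<close> that is not KKT the
  steps satisfy \<open>\<parallel>s\<parallel> \<ge> \<epsilon> \<alpha>\<close>, and every successful step there lowers the merit function by at least a
  multiple of \<open>\<parallel>s\<parallel>\<close>.  If \<open>\<alpha>\<close> stays away from zero, this contradicts boundedness of the merit function.
  If \<open>\<alpha>\<close> becomes small, then steps near \<open>x\<^sub>*\<close> cannot be rejected, and the summable merit decrease traps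
  the iterates near \<open>x\<^sub>*\<close>; then \<open>\<alpha>\<close> is constant after all.  The trial points \<open>x + s\<close> may lie
  outside \<open>X\<close>, so rejection is excluded by strict differentiability at \<open>x\<^sub>*\<close>.\<close>

section \<open>Projections and the Cauchy step\<close>

lemma norm_matrix_vector_le: "norm (A *v x) \<le> norm A * norm x" for A :: "real ^ 'n ^ 'm"
proof -
  have "\<bar>(A *v x) $ i\<bar> \<le> norm (A $ i) * norm x" for i
    by (simp add: matrix_vector_mul_component Cauchy_Schwarz_ineq2)
  then have "norm (A *v x) \<le> L2_set (\<lambda>i. norm (A $ i) * norm x) UNIV"
    unfolding norm_vec_def[of "A *v x"] by (intro L2_set_mono) auto
  then show ?thesis
    by (simp add: norm_vec_def[of A] L2_set_left_distrib)
qed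

lemma inner_transpose: "h \<bullet> (transpose A *v y) = (A *v h) \<bullet> y" for A :: "real ^ 'n ^ 'm"
  by (metis dot_lmul_matrix inner_commute transpose_matrix_vector)

text \<open>Pairing \<open>transpose A *v y\<close> with itself moves the matrix to the other
  factor, so the norm of \<open>A\<close> itself appears in the bound; one factor
  \<open>norm d\<close> then cancels.\<close>

lemma norm_transpose_vector_le: "norm (transpose A *v y) \<le> norm A * norm y"
  for A :: "real ^ 'n ^ 'm"
proof -
  define d where "d = transpose A *v y"
  have "norm d * norm d = (A *v d) \<bullet> y"
    unfolding inner_transpose[symmetric] d_def[symmetric]
    by (simp add: dot_square_norm power2_eq_square)
  also have "\<dots> \<le> norm (A *v d) * norm y" by (rule norm_cauchy_schwarz)
  also have "\<dots> \<le> (norm A * norm d) * norm y"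
    by (intro mult_right_mono norm_matrix_vector_le) auto
  finally have *: "norm d * norm d \<le> norm d * (norm A * norm y)" by (simp add: ac_simps)
  have "norm d \<le> norm A * norm y"
  proof (cases "norm d = 0")
    case False
    then have "0 < norm d" by simp
    with * show ?thesis by (rule mult_left_le_imp_le)
  qed (simp only: mult_nonneg_nonneg norm_ge_zero)
  then show ?thesis by (simp only: d_def)
qed

lemma tendsto_matrix_vector:
  fixes A :: "'a \<Rightarrow> real ^ 'n ^ 'm"
  assumes "(A \<longlongrightarrow> A0) F" "(h \<longlongrightarrow> h0) F"
  shows "((\<lambda>k. A k *v h k) \<longlongrightarrow> A0 *v h0) F"
  unfolding matrix_vector_mult_def
  by (intro tendsto_vec_lambda tendsto_sum tendsto_mult tendsto_vec_nth assms)

lemma gradient_eqI: "gradient h x = D" if "GDERIV h x :> D"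
proof -
  have "E = D" if "GDERIV h x :> E" for E
  proof -
    have "(\<lambda>v. v \<bullet> E) = (\<lambda>v. v \<bullet> D)"
      using that \<open>GDERIV h x :> D\<close> unfolding gderiv_def by (rule has_derivative_unique)
    then show ?thesis by (metis inner_commute vector_eq_ldot)
  qed
  then show ?thesis unfolding gradient_def using that by blast
qed

text \<open>The derivative is represented by the vector of its values on the basis; uniqueness then
  makes the description in \<open>gradient\<close> denote this vector.\<close>

lemma GDERIV_gradient:
  fixes h :: "'a::euclidean_space \<Rightarrow> real"
  assumes "h differentiable at x"
  shows "GDERIV h x :> gradient h x"
proof -
  obtain D where D: "(h has_derivative D) (at x)" using assms differentiable_def by blast
  then have lin: "linear D" using has_derivative_linear by blast
  have "D = (\<lambda>v. v \<bullet> (\<Sum>b\<in>Basis. D b *\<^sub>R b))"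
  proof
    fix v
    have "D v = D (\<Sum>b\<in>Basis. (v \<bullet> b) *\<^sub>R b)" by (simp add: euclidean_representation)
    also have "\<dots> = (\<Sum>b\<in>Basis. (v \<bullet> b) * D b)"
      by (simp add: linear_sum[OF lin] linear_cmul[OF lin])
    finally show "D v = v \<bullet> (\<Sum>b\<in>Basis. D b *\<^sub>R b)" by (simp add: inner_sum_right mult.commute)
  qed
  then have "GDERIV h x :> (\<Sum>b\<in>Basis. D b *\<^sub>R b)" using D unfolding gderiv_def by simp
  then show ?thesis using gradient_eqI by metis
qed

section \<open>Coordinatewise projections onto the orthant and its tangent cones\<close>

lemma closest_point_componentwise:
  fixes S :: "(real ^ 'n) set"
  assumes "convex S" "closed S" "p \<in> S" "\<And>y i. y \<in> S \<Longrightarrow> \<bar>z $ i - p $ i\<bar> \<le> \<bar>z $ i - y $ i\<bar>"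
  shows "closest_point S z = p"
  by (rule closest_point_unique[symmetric])
     (use assms in \<open>auto simp: dist_norm intro!: norm_le_componentwise_cart\<close>)

lemma closed_Omega: "closed (Omega :: (real ^ 'n) set)"
  unfolding Omega_def by (intro closed_Collect_all closed_Collect_le continuous_intros)

text \<open>One computation serves both projections of the algorithm: \<open>P\<close> always true
  gives \<open>Omega\<close>, and \<open>P\<close> selecting the active coordinates gives the
  tangent cone.\<close>

lemma closest_point_orthant_face:
  "closest_point {d. \<forall>i. P i \<longrightarrow> 0 \<le> d $ i} z = (\<chi> i. if P i then max (z $ i) 0 else z $ i)"
  for z :: "real ^ 'n"
proof (rule closest_point_componentwise)
  show "closed {d :: real ^ 'n. \<forall>i. P i \<longrightarrow> 0 \<le> d $ i}"
    by (intro closed_Collect_all closed_Collect_imp closed_Collect_le continuous_intros) auto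
  show "convex {d :: real ^ 'n. \<forall>i. P i \<longrightarrow> 0 \<le> d $ i}"
    by (auto simp: convex_def)
  fix y :: "real ^ 'n" and i assume "y \<in> {d. \<forall>i. P i \<longrightarrow> 0 \<le> d $ i}"
  then have "P i \<Longrightarrow> 0 \<le> y $ i" by auto
  then show "\<bar>z $ i - (\<chi> i. if P i then max (z $ i) 0 else z $ i) $ i\<bar> \<le> \<bar>z $ i - y $ i\<bar>"
    by auto
qed auto

lemma closest_point_Omega: "closest_point Omega z $ i = max (z $ i) 0"
  using closest_point_orthant_face[of "\<lambda>_. True" z] by (simp add: Omega_def)

text \<open>At an active coordinate all difference quotients are nonnegative, hence so is their
  limit. Conversely, the straight line in direction \<open>d\<close> stays in \<open>Omega\<close>
  for all small parameters.\<close>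

lemma tangent_cone_Omega:
  fixes x :: "real ^ 'n"
  assumes "x \<in> Omega"
  shows "tangent_cone Omega x = {d. \<forall>i. x $ i = 0 \<longrightarrow> 0 \<le> d $ i}"
proof (intro equalityI subsetI)
  fix d :: "real ^ 'n" assume "d \<in> tangent_cone Omega x"
  then obtain y :: "nat \<Rightarrow> real ^ 'n" and t :: "nat \<Rightarrow> real" where
    y: "\<And>j. y j \<in> Omega" "\<And>j. t j > 0" "(\<lambda>j. (y j - x) /\<^sub>R t j) \<longlonglongrightarrow> d"
    unfolding tangent_cone_def by blast
  have "0 \<le> d $ i" if "x $ i = 0" for i
  proof (rule tendsto_lowerbound[OF tendsto_vec_nth[OF y(3)]])
    show "\<forall>\<^sub>F j in sequentially. 0 \<le> ((y j - x) /\<^sub>R t j) $ i"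
      using y(1,2) that by (auto simp: Omega_def less_imp_le)
  qed auto
  then show "d \<in> {d. \<forall>i. x $ i = 0 \<longrightarrow> 0 \<le> d $ i}" by auto
next
  fix d :: "real ^ 'n" assume d: "d \<in> {d. \<forall>i. x $ i = 0 \<longrightarrow> 0 \<le> d $ i}"
  have "\<forall>i. \<exists>e>0. \<forall>t. 0 < t \<and> t \<le> e \<longrightarrow> 0 \<le> x $ i + t * d $ i"
  proof
    fix i
    show "\<exists>e>0. \<forall>t. 0 < t \<and> t \<le> e \<longrightarrow> 0 \<le> x $ i + t * d $ i"
    proof (cases "0 \<le> d $ i")
      case True
      then show ?thesis using assms by (auto simp: Omega_def intro!: exI[of _ 1])
    next
      case False
      then have "x $ i > 0" using d assms by (force simp: Omega_def less_le)
      moreover have "0 \<le> x $ i + t * d $ i" if "0 < t" "t \<le> x $ i / - d $ i" for t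
        using that False by (simp add: field_simps)
      ultimately show ?thesis using False by (intro exI[of _ "x $ i / - d $ i"]) (auto simp: divide_pos_neg)
    qed
  qed
  then obtain e where e: "\<And>i. e i > 0" "\<And>i t. 0 < t \<Longrightarrow> t \<le> e i \<Longrightarrow> 0 \<le> x $ i + t * d $ i"
    by metis
  \<comment> \<open>Finitely many coordinates, so their admissible step lengths have a positive
    common bound.\<close>
  define m where "m = Min (range e)"
  have m: "m > 0" "\<And>i. m \<le> e i" unfolding m_def using e(1) by auto
  define t where "t j = m * inverse (real (Suc j))" for j
  have t: "t j > 0" "t j \<le> m" for j using m by (auto simp: t_def field_simps)
  have t0: "t \<longlonglongrightarrow> 0" unfolding t_def
    using tendsto_mult_right_zero[OF LIMSEQ_inverse_real_of_nat] by auto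
  show "d \<in> tangent_cone Omega x" unfolding tangent_cone_def mem_Collect_eq
  proof (intro exI[of _ "\<lambda>j. x + t j *\<^sub>R d"] exI[of _ t] conjI allI)
    show "x + t j *\<^sub>R d \<in> Omega" for j
      using e(2)[OF t(1) order_trans[OF t(2) m(2)]] by (auto simp: Omega_def)
    show "(\<lambda>j. x + t j *\<^sub>R d) \<longlonglongrightarrow> x" using t0 by (auto intro!: tendsto_eq_intros)
    show "(\<lambda>j. (x + t j *\<^sub>R d - x) /\<^sub>R t j) \<longlonglongrightarrow> d"
      using t(1) by (simp add: less_imp_neq[THEN not_sym])
  qed (use t t0 in auto)
qed

section \<open>The projected gradient step and the decrease at the Cauchy point\<close>

definition feas_grad :: "(real ^ 'n \<Rightarrow> real ^ 'm) \<Rightarrow> real ^ 'n \<Rightarrow> real ^ 'n" where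
  "feas_grad c x = transpose (Jac c x) *v c x"

lemma v_proj_nth: "v_proj c x \<beta> $ i = - min (x $ i) (\<beta> * feas_grad c x $ i)"
  unfolding v_proj_def feas_grad_def[symmetric] by (auto simp: closest_point_Omega)

lemma delta_alt:
  assumes "x \<in> Omega"
  shows "delta c x =
    norm (\<chi> i. if x $ i = 0 then max (- (feas_grad c x $ i)) 0 else - (feas_grad c x $ i))"
  unfolding delta_def feas_grad_def[symmetric] tangent_cone_Omega[OF assms]
  by (intro arg_cong[where f = norm]) (simp add: closest_point_orthant_face vec_eq_iff)

lemma delta_nonneg: "0 \<le> delta c x" by (simp add: delta_def)

lemma delta_le: "x \<in> Omega \<Longrightarrow> delta c x \<le> norm (feas_grad c x)"
  unfolding delta_alt by (intro norm_le_componentwise_cart) auto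

text \<open>Clipping at zero only shortens the move along the negative gradient. At an active
  coordinate it suppresses a move to negative values, exactly as the projection in
  \<open>delta\<close> does.\<close>

lemma norm_v_proj_le:
  assumes "x \<in> Omega" "0 < \<beta>"
  shows "norm (v_proj c x \<beta>) \<le> \<beta> * delta c x"
proof -
  define w where "w = (\<chi> i. if x $ i = 0 then max (- (feas_grad c x $ i)) 0 else - (feas_grad c x $ i))"
  have "\<bar>v_proj c x \<beta> $ i\<bar> \<le> \<beta> * \<bar>w $ i\<bar>" for i
  proof -
    have "0 \<le> x $ i" using assms by (simp add: Omega_def)
    moreover have "\<beta> * \<bar>w $ i\<bar> = \<bar>\<beta> * w $ i\<bar>" using assms by (simp add: abs_mult)
    moreover have "feas_grad c x $ i \<ge> 0 \<Longrightarrow> \<beta> * feas_grad c x $ i \<ge> 0"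
      "feas_grad c x $ i \<le> 0 \<Longrightarrow> \<beta> * feas_grad c x $ i \<le> 0"
      using assms by (auto simp: mult_nonneg_nonpos)
    ultimately show ?thesis using assms
      by (cases "feas_grad c x $ i \<ge> 0") (auto simp: v_proj_nth w_def max_def min_def)
  qed
  then have "norm (v_proj c x \<beta>) \<le> norm (\<beta> *\<^sub>R w)"
    using assms by (intro norm_le_componentwise_cart) (auto simp: abs_mult)
  then show ?thesis using assms by (simp add: delta_alt w_def)
qed

text \<open>Holds coordinate by coordinate: either the move is the full gradient move, with
  equality, or it is clipped and \<open>x $ i\<close> lies between 0 and
  \<open>\<beta> * feas_grad c x $ i\<close>.\<close>

lemma v_proj_descent:
  assumes "x \<in> Omega" "0 < \<beta>"
  shows "(norm (v_proj c x \<beta>))\<^sup>2 \<le> \<beta> * - (feas_grad c x \<bullet> v_proj c x \<beta>)"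
proof -
  have "(v_proj c x \<beta> $ i)\<^sup>2 \<le> \<beta> * (feas_grad c x $ i * min (x $ i) (\<beta> * feas_grad c x $ i))" for i
  proof (cases "x $ i \<le> \<beta> * feas_grad c x $ i")
    case True
    have "x $ i * x $ i \<le> (\<beta> * feas_grad c x $ i) * x $ i"
      using True assms by (intro mult_right_mono) (auto simp: Omega_def)
    then show ?thesis using True by (simp add: v_proj_nth power2_eq_square ac_simps)
  next
    case False
    then show ?thesis by (simp add: v_proj_nth power2_eq_square ac_simps)
  qed
  then have "(\<Sum>i\<in>UNIV. (v_proj c x \<beta> $ i)\<^sup>2)
      \<le> (\<Sum>i\<in>UNIV. \<beta> * (feas_grad c x $ i * min (x $ i) (\<beta> * feas_grad c x $ i)))"
    by (rule sum_mono)
  then show ?thesis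
    by (simp add: norm_vec_def L2_set_def sum_nonneg inner_vec_def v_proj_nth sum_negf sum_distrib_left)
qed

lemma m_model_expand:
  "m_model c x v = m_model c x 0 + feas_grad c x \<bullet> v + 1 / 2 * (norm (Jac c x *v v))\<^sup>2"
proof -
  have "feas_grad c x \<bullet> v = c x \<bullet> (Jac c x *v v)"
    unfolding feas_grad_def by (metis inner_commute inner_transpose)
  then show ?thesis unfolding m_model_def
    by (simp add: power2_norm_eq_inner inner_add inner_commute field_simps)
qed

lemma gradient_m_model: "gradient (m_model c x) 0 = feas_grad c x"
proof (rule gradient_eqI)
  have m: "m_model c x = (\<lambda>v. m_model c x 0 + feas_grad c x \<bullet> v + 1 / 2 * ((Jac c x *v v) \<bullet> (Jac c x *v v)))"
    by (intro ext, subst m_model_expand) (simp add: power2_norm_eq_inner)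
  have [derivative_intros]: "((\<lambda>v. Jac c x *v v) has_derivative (\<lambda>v. Jac c x *v v)) (at 0)"
    by (rule bounded_linear_imp_has_derivative) (rule matrix_vector_mul_bounded_linear)
  show "GDERIV (m_model c x) 0 :> feas_grad c x"
    unfolding gderiv_def by (subst m) (auto intro!: derivative_eq_intros simp: inner_commute)
qed

text \<open>The quadratic term of the model is at most \<open>M\<^sup>2\<close> times half of the
  squared step length, and \<open>v_proj_descent\<close> bounds this by a multiple of the predicted
  linear decrease. For small \<open>\<beta>\<close> it uses up at most the fraction
  \<open>1 - eta_m P\<close> of it.\<close>

lemma cauchy_acceptableI:
  assumes "x \<in> Omega" "valid_inputs P" "0 < \<beta>" "\<beta> \<le> kappa_v P * \<alpha>"
    and "\<And>h. norm (Jac c x *v h) \<le> M * norm h" "\<beta> * M\<^sup>2 \<le> 2 * (1 - eta_m P)"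
  shows "cauchy_acceptable P c x \<alpha> \<beta>"
proof -
  let ?v = "v_proj c x \<beta>" and ?d = "feas_grad c x"
  have "norm ?v \<le> \<beta> * delta c x" using norm_v_proj_le assms by blast
  also have "\<dots> \<le> kappa_v P * \<alpha> * delta c x"
    using assms by (intro mult_right_mono) (auto simp: delta_nonneg)
  finally have 1: "norm ?v \<le> kappa_v P * \<alpha> * delta c x" .
  have "\<beta> * (norm (Jac c x *v ?v))\<^sup>2 \<le> \<beta> * (M * norm ?v)\<^sup>2"
    using assms by (intro mult_left_mono power_mono) auto
  also have "\<dots> = (\<beta> * M\<^sup>2) * (norm ?v)\<^sup>2" by (simp add: power_mult_distrib)
  also have "\<dots> \<le> (2 * (1 - eta_m P)) * (norm ?v)\<^sup>2" using assms by (intro mult_right_mono) auto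
  also have "\<dots> \<le> (2 * (1 - eta_m P)) * (\<beta> * - (?d \<bullet> ?v))"
    using v_proj_descent[of x \<beta> c] assms by (intro mult_left_mono) (auto simp: valid_inputs_def)
  finally have "\<beta> * (norm (Jac c x *v ?v))\<^sup>2 \<le> \<beta> * ((2 * (1 - eta_m P)) * - (?d \<bullet> ?v))"
    by (simp add: ac_simps)
  then have "(norm (Jac c x *v ?v))\<^sup>2 \<le> (2 * (1 - eta_m P)) * - (?d \<bullet> ?v)"
    using assms by (simp only: mult_le_cancel_left_pos)
  then have "m_model c x ?v \<le> m_model c x 0 + eta_m P * (?d \<bullet> ?v)"
    by (subst m_model_expand) (simp add: algebra_simps)
  with 1 show ?thesis unfolding cauchy_acceptable_def gradient_m_model by simp
qed

text \<open>Every \<open>\<beta>\<close> below a threshold is acceptable. So either the first trial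
  value 1 is accepted, or the value before the accepted one lies above the threshold.\<close>

lemma cauchy_point_obtain:
  assumes "x \<in> Omega" "valid_inputs P" "0 < \<alpha>" "0 < M"
    and M: "\<And>h. norm (Jac c x *v h) \<le> M * norm h"
  obtains \<beta> where "cauchy_point P c x \<alpha> = v_proj c x \<beta>" "cauchy_acceptable P c x \<alpha> \<beta>"
    "min 1 (gam P * min (kappa_v P * \<alpha>) (2 * (1 - eta_m P) / M\<^sup>2)) \<le> \<beta>" "0 < \<beta>" "\<beta> \<le> 1"
proof -
  let ?b = "min (kappa_v P * \<alpha>) (2 * (1 - eta_m P) / M\<^sup>2)"
  let ?Q = "\<lambda>i. cauchy_acceptable P c x \<alpha> (gam P ^ i)"
  have g: "0 < gam P" "gam P < 1" and b: "0 < ?b"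
    using assms by (auto simp: valid_inputs_def)
  have acc: "?Q i" if "gam P ^ i \<le> ?b" for i
    using that g assms by (intro cauchy_acceptableI[OF assms(1,2) _ _ M]) (auto simp: field_simps)
  obtain n where "gam P ^ n < ?b" using real_arch_pow_inv[OF b g(2)] by blast
  then have "?Q n" using acc by simp
  define i where "i = (LEAST i. ?Q i)"
  have "?Q i" unfolding i_def using \<open>?Q n\<close> by (rule LeastI)
  moreover have "min 1 (gam P * ?b) \<le> gam P ^ i"
  proof (cases i)
    case (Suc j)
    then have "\<not> ?Q j" unfolding i_def using not_less_Least by (metis lessI)
    then have "?b \<le> gam P ^ j" using acc by force
    then have "gam P * ?b \<le> gam P ^ i" unfolding Suc using g by simp
    then show ?thesis by linarith
  qed simp
  ultimately show thesis
    using that[of "gam P ^ i"] g by (auto simp: cauchy_point_def i_def power_le_one)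
qed

lemma normal_step_decrease:
  assumes "x \<in> Omega" "valid_inputs P" "0 < \<alpha>" "0 < M"
    and M: "\<And>h. norm (Jac c x *v h) \<le> M * norm h"
    and "normal_step P c x \<alpha> v" "delta c x \<noteq> 0"
  obtains \<beta> where "min 1 (gam P * min (kappa_v P * \<alpha>) (2 * (1 - eta_m P) / M\<^sup>2)) \<le> \<beta>" "0 < \<beta>" "\<beta> \<le> 1"
    "eta_m P * - (feas_grad c x \<bullet> v_proj c x \<beta>) \<le> norm (c x) * lin_decrease c x v"
proof -
  obtain \<beta> where \<beta>: "cauchy_point P c x \<alpha> = v_proj c x \<beta>" "cauchy_acceptable P c x \<alpha> \<beta>"
    "min 1 (gam P * min (kappa_v P * \<alpha>) (2 * (1 - eta_m P) / M\<^sup>2)) \<le> \<beta>" "0 < \<beta>" "\<beta> \<le> 1"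
    using cauchy_point_obtain[OF assms(1-5)] by metis
  have "m_model c x v \<le> m_model c x 0 + eta_m P * (feas_grad c x \<bullet> v_proj c x \<beta>)"
    using assms(6,7) \<beta>(1,2) by (auto simp: normal_step_def cauchy_acceptable_def gradient_m_model)
  then have "eta_m P * - (feas_grad c x \<bullet> v_proj c x \<beta>) \<le>
      1 / 2 * ((norm (c x))\<^sup>2 - (norm (c x + Jac c x *v v))\<^sup>2)"
    by (simp add: m_model_def field_simps)
  \<comment> \<open>This is \<open>(a\<^sup>2 - b\<^sup>2) / 2 \<le> a * (a - b)\<close> for the
    residual norms, equivalent to \<open>0 \<le> (a - b)\<^sup>2\<close>.\<close>
  also have "\<dots> \<le> norm (c x) * lin_decrease c x v"
    using zero_le_power2[of "norm (c x) - norm (c x + Jac c x *v v)"]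
    by (simp add: lin_decrease_def power2_eq_square algebra_simps)
  finally show thesis using that \<beta> by blast
qed

text \<open>If \<open>delta c x\<close> is nonzero, then every projected step is nonzero and its
  predicted decrease positive. Otherwise the normal step is zero.\<close>

lemma normal_step_decrease_pos:
  assumes "x \<in> Omega" "valid_inputs P" "0 < \<alpha>" "normal_step P c x \<alpha> v"
  shows "0 \<le> lin_decrease c x v" and "v \<noteq> 0 \<Longrightarrow> 0 < lin_decrease c x v"
proof -
  have pos: "0 < lin_decrease c x v" if d: "delta c x \<noteq> 0"
  proof -
    have "0 < norm (Jac c x) + 1" by (smt (verit) norm_ge_zero)
    moreover have "norm (Jac c x *v h) \<le> (norm (Jac c x) + 1) * norm h" for h
      using norm_matrix_vector_le[of "Jac c x" h] by (smt (verit) mult_right_mono norm_ge_zero)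
    ultimately obtain \<beta> where \<beta>: "0 < \<beta>"
      "eta_m P * - (feas_grad c x \<bullet> v_proj c x \<beta>) \<le> norm (c x) * lin_decrease c x v"
      using normal_step_decrease[OF assms(1-3) _ _ assms(4) d] by metis
    have "v_proj c x \<beta> \<noteq> 0"
    proof
      assume 0: "v_proj c x \<beta> = 0"
      have "(if x $ i = 0 then max (- (feas_grad c x $ i)) 0 else - (feas_grad c x $ i)) = 0" for i
      proof -
        have "min (x $ i) (\<beta> * feas_grad c x $ i) = 0"
          using 0 v_proj_nth[of c x \<beta> i] by simp
        then show ?thesis using \<beta>(1) by (auto simp: min_def max_def zero_le_mult_iff split: if_splits)
      qed
      then have "delta c x = 0" unfolding delta_alt[OF assms(1)] by (simp add: vec_eq_iff)
      with d show False by simp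
    qed
    then have "0 < (norm (v_proj c x \<beta>))\<^sup>2" by simp
    also have "\<dots> \<le> \<beta> * - (feas_grad c x \<bullet> v_proj c x \<beta>)"
      by (rule v_proj_descent[OF assms(1) \<beta>(1)])
    finally have "0 < - (feas_grad c x \<bullet> v_proj c x \<beta>)" using \<beta>(1) zero_less_mult_pos by blast
    then have "0 < norm (c x) * lin_decrease c x v"
      using \<beta>(2) assms(2) by (smt (verit) valid_inputs_def greaterThanLessThan_iff mult_pos_pos)
    then show ?thesis by (metis norm_ge_zero zero_less_mult_pos zero_less_mult_pos2 zero_less_mult_iff not_less)
  qed
  show "0 \<le> lin_decrease c x v"
  proof (cases "delta c x = 0")
    case True
    then show ?thesis using assms(4) by (simp add: normal_step_def lin_decrease_def)
  qed (use pos in simp)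
  show "0 < lin_decrease c x v" if "v \<noteq> 0"
    using pos that assms(4) by (auto simp: normal_step_def split: if_splits)
qed

section \<open>Decrease of the linearized constraints under LICQ\<close>

text \<open>The stacked matrix maps into the coordinate subspace \<open>S\<close> where the inactive
  identity entries vanish. LICQ says that its rank is the dimension of \<open>S\<close>, so it maps
  onto \<open>S\<close>.\<close>

lemma licq_onto:
  fixes c :: "real ^ 'n \<Rightarrow> real ^ 'm"
  assumes "licq c x"
  obtains h where "Jac c x *v h = a" "\<And>i. x $ i = 0 \<Longrightarrow> h $ i = b $ i"
proof -
  let ?M = "stacked_matrix c x" and ?A = "active_set x"
  define d :: "('m + 'n) set" where "d = range Inl \<union> Inr ` ?A"
  define S where "S = {w :: real ^ ('m + 'n). \<forall>k. k \<notin> d \<longrightarrow> w $ k = 0}"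
  have "row i (mat 1 :: real ^ 'n ^ 'n) = axis i 1" for i
    by (auto simp: row_def mat_def axis_def vec_eq_iff)
  then have M: "(?M *v h) $ Inl j = (Jac c x *v h) $ j"
    "(?M *v h) $ Inr i = (if i \<in> ?A then h $ i else 0)" for h i j
    by (auto simp: stacked_matrix_def matrix_vector_mul_component row_def inner_axis')
  have "card d = CARD('m) + card ?A"
    unfolding d_def by (subst card_Un_disjoint) (auto simp: card_image)
  then have dimS: "dim S = CARD('m) + card ?A"
    unfolding S_def by (simp add: dim_substandard_cart flip: dim_vec_eq)
  have "range ((*v) ?M) = S"
  proof (rule subspace_dim_equal)
    show "subspace (range ((*v) ?M))"
      by (intro linear_subspace_image matrix_vector_mul_linear subspace_UNIV)
    show "subspace S" by (auto simp: S_def subspace_def)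
    have "(?M *v h) $ k = 0" if "k \<notin> d" for h k
      using that M by (cases k) (auto simp: d_def)
    then show "range ((*v) ?M) \<subseteq> S" by (auto simp: S_def)
    show "dim S \<le> dim (range ((*v) ?M))"
      using assms dimS by (simp add: licq_def rank_dim_range)
  qed
  define w where "w = (\<chi> k. case k of Inl j \<Rightarrow> a $ j | Inr i \<Rightarrow> if i \<in> ?A then b $ i else 0)"
  have "w \<in> S"
    by (auto simp: w_def S_def d_def split: sum.splits)
  then obtain h where h: "?M *v h = w"
    using \<open>range ((*v) ?M) = S\<close> by auto
  have w: "w $ Inl j = a $ j" "i \<in> ?A \<Longrightarrow> w $ Inr i = b $ i" for i j
    by (simp_all add: w_def)
  show thesis
  proof
    show "Jac c x *v h = a"
      using M(1)[of h] w(1) h by (simp add: vec_eq_iff)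
    show "h $ i = b $ i" if "x $ i = 0" for i
      using M(2)[of h i] w(2)[of i] h that by (simp add: active_set_def)
  qed
qed

text \<open>The columns of \<open>B\<close> solve \<open>Jac c x *v h = axis j 1\<close> with zero
  active coordinates, so moving along the range of \<open>B\<close> leaves the active bounds
  untouched.\<close>

lemma licq_right_inverse:
  fixes c :: "real ^ 'n \<Rightarrow> real ^ 'm"
  assumes "licq c x"
  obtains B where "\<And>w. Jac c x *v (B *v w) = w" "\<And>w i. x $ i = 0 \<Longrightarrow> (B *v w) $ i = 0"
proof -
  have "\<exists>h. Jac c x *v h = axis j 1 \<and> (\<forall>i. x $ i = 0 \<longrightarrow> h $ i = 0)" for j
    using licq_onto[OF assms, of "axis j 1" 0] by (metis zero_index)
  then obtain h where h: "\<And>j. Jac c x *v h j = axis j 1" "\<And>i j. x $ i = 0 \<Longrightarrow> h j $ i = 0"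
    by metis
  define B where "B = (\<chi> i j. h j $ i)"
  have B: "B *v w = (\<Sum>j\<in>UNIV. w $ j *\<^sub>R h j)" for w
    by (simp add: vec_eq_iff B_def matrix_vector_mult_def mult.commute)
  show thesis
  proof
    fix w :: "real ^ 'm"
    have "Jac c x *v (B *v w) = (\<Sum>j\<in>UNIV. w $ j *\<^sub>R axis j 1)"
      unfolding B by (simp add: linear_sum[OF matrix_vector_mul_linear] matrix_vector_mult_scaleR h)
    also have "\<dots> = w" using basis_expansion[of w] by (simp add: scalar_mult_eq_scaleR)
    finally show "Jac c x *v (B *v w) = w" .
    show "(B *v w) $ i = 0" if "x $ i = 0" for i
      using h(2)[OF that] by (simp add: B)
  qed
qed

text \<open>Properties near \<open>p\<close> are stated with \<open>nhds p\<close> rather than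
  \<open>at p\<close> because iterates may coincide with their limit point.\<close>

lemma isCont_nhds: "isCont f p \<Longrightarrow> (f \<longlongrightarrow> f p) (nhds p)"
  unfolding isCont_def by (rule tendsto_at_iff_tendsto_nhds[THEN iffD1])

text \<open>The right inverse found at \<open>p\<close> is kept fixed; at \<open>x\<close> its error
  is \<open>(Jac c x - Jac c p) *v (B *v w)\<close>, small by continuity of the Jacobian.\<close>

lemma licq_approx_right_inverse:
  fixes c :: "real ^ 'n \<Rightarrow> real ^ 'm"
  assumes "licq c p" "isCont (Jac c) p"
  obtains B where "\<And>w i. p $ i = 0 \<Longrightarrow> (B *v w) $ i = 0"
    "\<forall>\<^sub>F x in nhds p. \<forall>w. norm (Jac c x *v (B *v w) - w) \<le> norm w / 2"
proof -
  obtain B where B: "\<And>w. Jac c p *v (B *v w) = w" "\<And>w i. p $ i = 0 \<Longrightarrow> (B *v w) $ i = 0"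
    using licq_right_inverse[OF assms(1)] by blast
  have "((\<lambda>x. norm (Jac c x - Jac c p) * norm B) \<longlongrightarrow> norm (Jac c p - Jac c p) * norm B) (nhds p)"
    by (intro tendsto_intros isCont_nhds assms(2))
  then have "\<forall>\<^sub>F x in nhds p. norm (Jac c x - Jac c p) * norm B < 1 / 2"
    by (rule order_tendstoD) simp
  then have "\<forall>\<^sub>F x in nhds p. \<forall>w. norm (Jac c x *v (B *v w) - w) \<le> norm w / 2"
  proof eventually_elim
    case (elim x)
    show ?case
    proof
      fix w
      have "norm (Jac c x *v (B *v w) - w) = norm ((Jac c x - Jac c p) *v (B *v w))"
        by (simp add: matrix_vector_mult_diff_rdistrib B)
      also have "\<dots> \<le> norm (Jac c x - Jac c p) * (norm B * norm w)"
        by (meson norm_matrix_vector_le order_trans mult_left_mono norm_ge_zero)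
      also have "\<dots> \<le> 1 / 2 * norm w"
        unfolding mult.assoc[symmetric] using elim by (intro mult_right_mono) auto
      finally show "norm (Jac c x *v (B *v w) - w) \<le> norm w / 2" by simp
    qed
  qed
  with B(2) show thesis using that by blast
qed

lemma eventually_inactive:
  fixes p :: "real ^ 'n"
  assumes "p \<in> Omega"
  obtains \<rho> where "0 < \<rho>" "\<forall>\<^sub>F x in nhds p. \<forall>i. p $ i \<noteq> 0 \<longrightarrow> \<rho> \<le> x $ i"
proof -
  \<comment> \<open>Half of the smallest positive coordinate of \<open>p\<close>; the entry 1 keeps
    the set nonempty when every coordinate is active.\<close>
  define \<rho> where "\<rho> = Min (insert 1 ((\<lambda>i. p $ i / 2) ` {i. p $ i \<noteq> 0}))"
  have pos: "0 < p $ i" if "p $ i \<noteq> 0" for i using that assms by (simp add: Omega_def less_le)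
  have "0 < \<rho>" unfolding \<rho>_def using pos by (subst Min_gr_iff) auto
  moreover have "\<forall>\<^sub>F x in nhds p. p $ i \<noteq> 0 \<longrightarrow> \<rho> \<le> x $ i" for i
  proof (cases "p $ i = 0")
    case False
    have "\<rho> \<le> p $ i / 2" unfolding \<rho>_def using False by (intro Min_le) auto
    then have "\<rho> < p $ i" using pos[OF False] by simp
    moreover have "((\<lambda>x. x $ i) \<longlongrightarrow> p $ i) (nhds p)" by (intro tendsto_intros filterlim_ident)
    ultimately have "\<forall>\<^sub>F x in nhds p. \<rho> < x $ i" by (rule order_tendstoD(1)[rotated])
    then show ?thesis by eventually_elim simp
  qed simp
  ultimately show thesis using that by (simp add: eventually_all_finite)
qed

text \<open>Coordinates inactive at \<open>p\<close> have room to move, so the predicted decrease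
  dominates \<open>\<beta>\<close> times the squared norm of the gradient \<open>J\<^sup>T c\<close>
  restricted to them. Pairing \<open>J\<^sup>T c\<close> with \<open>B *v c x\<close>, which
  vanishes at the other coordinates, shows that this restricted gradient is at least a multiple of
  \<open>norm (c x)\<close>.\<close>

lemma licq_normal_decrease:
  fixes c :: "real ^ 'n \<Rightarrow> real ^ 'm"
  assumes licq: "licq c p" and p: "p \<in> Omega" and J: "isCont (Jac c) p" and c: "isCont c p"
    and P: "valid_inputs P" and a0: "0 < a0"
  obtains C where "0 < C"
    "\<forall>\<^sub>F x in nhds p. \<forall>\<alpha> v. x \<in> Omega \<longrightarrow> 0 < \<alpha> \<longrightarrow> \<alpha> \<le> a0 \<longrightarrow> normal_step P c x \<alpha> v \<longrightarrow>
       \<not> stops_infeasible c x \<longrightarrow> C * \<alpha> * norm (c x) \<le> lin_decrease c x v"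
proof -
  obtain B where B: "\<And>w i. p $ i = 0 \<Longrightarrow> (B *v w) $ i = 0"
    and ev1: "\<forall>\<^sub>F x in nhds p. \<forall>w. norm (Jac c x *v (B *v w) - w) \<le> norm w / 2"
    using licq_approx_right_inverse[OF licq J] by blast
  obtain \<rho> where \<rho>: "0 < \<rho>" and ev2: "\<forall>\<^sub>F x in nhds p. \<forall>i. p $ i \<noteq> 0 \<longrightarrow> \<rho> \<le> x $ i"
    using eventually_inactive[OF p] by blast
  define M where "M = norm (Jac c p) + 1"
  define D where "D = M * (norm (c p) + 1)"
  have M0: "0 < M" unfolding M_def by (simp add: add_nonneg_pos)
  have "0 < norm (c p) + 1" by (simp add: add_nonneg_pos)
  then have D0: "0 < D" unfolding D_def using M0 by simp
  have Jt: "((\<lambda>x. norm (Jac c x)) \<longlongrightarrow> norm (Jac c p)) (nhds p)"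
    and ct: "((\<lambda>x. norm (c x)) \<longlongrightarrow> norm (c p)) (nhds p)"
    using J c by (auto intro!: tendsto_norm isCont_nhds)
  have ev3: "\<forall>\<^sub>F x in nhds p. norm (Jac c x) < M"
    by (rule order_tendstoD(2)[OF Jt]) (simp add: M_def)
  have ev4: "\<forall>\<^sub>F x in nhds p. norm (c x) < norm (c p) + 1"
    by (rule order_tendstoD(2)[OF ct]) simp
  \<comment> \<open>\<open>K\<close> ensures that a move \<open>K * \<beta> * d\<close> with
    \<open>\<beta> \<le> 1\<close> and \<open>d \<le> D\<close> stays within the room
    \<open>\<rho>\<close>. \<open>C1 * \<alpha>\<close> is a linear lower bound, valid up to
    \<open>a0\<close>, for the backtracking length \<open>\<beta>\<close>. The 4 in \<open>C\<close>
    comes from squaring the factor 1/2 lost by the approximate right inverse.\<close>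
  define K where "K = min 1 (\<rho> / D)"
  define C1 where "C1 = min (1 / a0) (gam P * min (kappa_v P) (2 * (1 - eta_m P) / M\<^sup>2 / a0))"
  define C where "C = eta_m P * K * C1 / (4 * ((norm B)\<^sup>2 + 1))"
  have K: "0 < K" "K \<le> 1"
    using \<rho> D0 by (simp_all add: K_def)
  have "K * D \<le> \<rho> / D * D" using D0 by (intro mult_right_mono) (simp_all add: K_def)
  then have KD: "K * D \<le> \<rho>" using D0 by simp
  have C1: "0 < C1" using P a0 M0 by (simp add: C1_def valid_inputs_def)
  have nB: "0 < (norm B)\<^sup>2 + 1" by (simp add: add_nonneg_pos)
  have eta: "0 < eta_m P" using P by (simp add: valid_inputs_def)
  have C0: "0 < C" unfolding C_def using K C1 eta nB by simp
  have C1_le: "C1 * \<alpha> \<le> min 1 (gam P * min (kappa_v P * \<alpha>) (2 * (1 - eta_m P) / M\<^sup>2))"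
    if "0 < \<alpha>" "\<alpha> \<le> a0" for \<alpha>
  proof -
    have g: "0 < gam P" "0 < 1 - eta_m P" using P by (auto simp: valid_inputs_def)
    have "C1 * \<alpha> \<le> 1 / a0 * \<alpha>" using that by (intro mult_right_mono) (auto simp: C1_def)
    also have "\<dots> \<le> 1" using that by simp
    finally have 1: "C1 * \<alpha> \<le> 1" .
    have "C1 * \<alpha> \<le> gam P * min (kappa_v P) (2 * (1 - eta_m P) / M\<^sup>2 / a0) * \<alpha>"
      using that by (intro mult_right_mono) (auto simp: C1_def)
    also have "\<dots> = gam P * min (kappa_v P * \<alpha>) (2 * (1 - eta_m P) / M\<^sup>2 / a0 * \<alpha>)"
      using that by (simp add: min_mult_distrib_right mult.assoc)
    also have "\<dots> \<le> gam P * min (kappa_v P * \<alpha>) (2 * (1 - eta_m P) / M\<^sup>2)"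
    proof -
      have "2 * (1 - eta_m P) / M\<^sup>2 * (\<alpha> / a0) \<le> 2 * (1 - eta_m P) / M\<^sup>2 * 1"
        using that g by (intro mult_left_mono) auto
      then show ?thesis using g by (intro mult_left_mono[OF min.mono[OF order_refl]]) (auto simp: ac_simps)
    qed
    finally show ?thesis using 1 by simp
  qed
  have "\<forall>\<^sub>F x in nhds p. \<forall>\<alpha> v. x \<in> Omega \<longrightarrow> 0 < \<alpha> \<longrightarrow> \<alpha> \<le> a0 \<longrightarrow> normal_step P c x \<alpha> v \<longrightarrow>
       \<not> stops_infeasible c x \<longrightarrow> C * \<alpha> * norm (c x) \<le> lin_decrease c x v"
    using ev1 ev2 ev3 ev4
  proof eventually_elim
    case (elim x)
    show ?case
    proof (intro allI impI)
      fix \<alpha> v assume x: "x \<in> Omega" and \<alpha>: "0 < \<alpha>" "\<alpha> \<le> a0" and v: "normal_step P c x \<alpha> v"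
        and ns: "\<not> stops_infeasible c x"
      show "C * \<alpha> * norm (c x) \<le> lin_decrease c x v"
      proof (cases "c x = 0")
        case True
        then show ?thesis using normal_step_decrease_pos(1)[OF x P \<alpha>(1) v] by simp
      next
        case False
        then have \<delta>: "delta c x \<noteq> 0" using ns by (simp add: stops_infeasible_def)
        let ?d = "feas_grad c x" and ?w = "c x"
        have JM: "norm (Jac c x *v h) \<le> M * norm h" for h
          using norm_matrix_vector_le[of "Jac c x" h] elim(3)
          by (smt (verit) mult_right_mono norm_ge_zero)
        obtain \<beta> where \<beta>: "C1 * \<alpha> \<le> \<beta>" "0 < \<beta>" "\<beta> \<le> 1"
          and dec: "eta_m P * - (?d \<bullet> v_proj c x \<beta>) \<le> norm ?w * lin_decrease c x v"
          using normal_step_decrease[OF x P \<alpha>(1) M0 JM v \<delta>] C1_le[OF \<alpha>] by (metis order_trans)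
        \<comment> \<open>The gradient restricted to the coordinates inactive at the limit
          \<open>p\<close>, not at \<open>x\<close>.\<close>
        define dI where "dI = (\<chi> i. if p $ i = 0 then 0 else ?d $ i)"
        have "norm ?d \<le> norm (Jac c x) * norm ?w"
          unfolding feas_grad_def by (rule norm_transpose_vector_le)
        also have "\<dots> \<le> D" unfolding D_def using elim(3,4) M0 by (intro mult_mono) auto
        finally have dD: "norm ?d \<le> D" .
        \<comment> \<open>Either the gradient move is not clipped, or it is clipped at
          \<open>x $ i\<close>; for \<open>i\<close> inactive at \<open>p\<close> this is at least
          \<open>\<rho>\<close>, hence at least \<open>K\<close> times the full move.\<close>
        have coord: "K * \<beta> * (dI $ i)\<^sup>2 \<le> ?d $ i * min (x $ i) (\<beta> * ?d $ i)" for i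
        proof (cases "\<beta> * ?d $ i \<le> x $ i")
          case True
          have "K * \<beta> * (dI $ i)\<^sup>2 \<le> 1 * \<beta> * (?d $ i)\<^sup>2"
            using K \<beta> by (intro mult_mono) (auto simp: dI_def)
          then show ?thesis using True by (simp add: min_absorb2 power2_eq_square ac_simps)
        next
          case False
          have x0: "0 \<le> x $ i" using x by (simp add: Omega_def)
          then have d0: "0 < ?d $ i" using False \<beta>(2) by (smt (verit) zero_less_mult_pos)
          have "\<beta> * ?d $ i \<le> 1 * D" using component_le_norm_cart[of ?d i] dD \<beta> d0
            by (intro mult_mono) auto
          then have "K * (\<beta> * ?d $ i) \<le> K * D" using K by (intro mult_left_mono) auto
          then have "K * (\<beta> * ?d $ i) \<le> \<rho>" using KD by linarith
          then have "p $ i \<noteq> 0 \<Longrightarrow> K * (\<beta> * ?d $ i) \<le> x $ i" using elim(2) by force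
          then have "p $ i \<noteq> 0 \<Longrightarrow> ?d $ i * (K * (\<beta> * ?d $ i)) \<le> ?d $ i * x $ i"
            using d0 by simp
          then show ?thesis using False x0 d0 by (auto simp: dI_def power2_eq_square ac_simps)
        qed
        have "K * \<beta> * (norm dI)\<^sup>2 = (\<Sum>i\<in>UNIV. K * \<beta> * (dI $ i)\<^sup>2)"
          by (simp add: norm_vec_def L2_set_def sum_nonneg sum_distrib_left)
        also have "\<dots> \<le> (\<Sum>i\<in>UNIV. ?d $ i * min (x $ i) (\<beta> * ?d $ i))" by (intro sum_mono coord)
        also have "\<dots> = - (?d \<bullet> v_proj c x \<beta>)" by (simp add: inner_vec_def v_proj_nth sum_negf)
        finally have 1: "K * \<beta> * (norm dI)\<^sup>2 \<le> - (?d \<bullet> v_proj c x \<beta>)" .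
        have "(B *v ?w) \<bullet> ?d = (B *v ?w) \<bullet> dI"
          using B by (auto simp: inner_vec_def dI_def intro!: sum.cong)
        moreover have "(B *v ?w) \<bullet> ?d = (Jac c x *v (B *v ?w)) \<bullet> ?w"
          by (subst feas_grad_def) (rule inner_transpose)
        ultimately have "?w \<bullet> ?w = (B *v ?w) \<bullet> dI - (Jac c x *v (B *v ?w) - ?w) \<bullet> ?w"
          by (simp add: inner_diff_left)
        also have "\<dots> \<le> norm (B *v ?w) * norm dI + norm (Jac c x *v (B *v ?w) - ?w) * norm ?w"
          using norm_cauchy_schwarz[of "B *v ?w" dI] Cauchy_Schwarz_ineq2[of "Jac c x *v (B *v ?w) - ?w" ?w]
          by linarith
        also have "\<dots> \<le> (norm B * norm ?w) * norm dI + (norm ?w / 2) * norm ?w"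
          using elim(1) by (intro add_mono mult_right_mono norm_matrix_vector_le) auto
        finally have "norm ?w * (norm ?w / 2) \<le> norm ?w * (norm B * norm dI)"
          by (simp add: power2_eq_square ac_simps flip: power2_norm_eq_inner)
        then have "norm ?w / 2 \<le> norm B * norm dI" using False by simp
        then have "(norm ?w / 2)\<^sup>2 \<le> (norm B * norm dI)\<^sup>2" by (intro power_mono) auto
        also have "\<dots> \<le> ((norm B)\<^sup>2 + 1) * (norm dI)\<^sup>2"
          by (simp add: power_mult_distrib distrib_right)
        finally have 2: "(norm ?w)\<^sup>2 / (4 * ((norm B)\<^sup>2 + 1)) \<le> (norm dI)\<^sup>2"
          using nB by (simp add: field_simps)
        \<comment> \<open>Both bounds carry an extra factor \<open>norm ?w\<close>, which is
          cancelled at the end.\<close>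
        have "norm ?w * (C * \<alpha> * norm ?w) = eta_m P * (K * (C1 * \<alpha>) * ((norm ?w)\<^sup>2 / (4 * ((norm B)\<^sup>2 + 1))))"
          by (simp add: C_def power2_eq_square)
        also have "\<dots> \<le> eta_m P * (K * \<beta> * (norm dI)\<^sup>2)"
          using eta K \<beta> 2 nB by (intro mult_left_mono mult_mono) auto
        also have "\<dots> \<le> norm ?w * lin_decrease c x v"
          using mult_left_mono[OF 1, of "eta_m P"] eta dec by linarith
        finally show ?thesis using False by simp
      qed
    qed
  qed
  with C0 show thesis using that by blast
qed

section \<open>Steps of the algorithm near a fixed point\<close>

text \<open>The mean value inequality on a ball, applied to \<open>f\<close> minus its linearization
  \<open>F p\<close>, costs \<open>e / 2\<close>; replacing \<open>F p\<close> by \<open>F x\<close>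
  costs the other half. The bound is uniform in both points.\<close>

lemma strict_derivative:
  fixes f :: "'a::euclidean_space \<Rightarrow> 'b::real_normed_vector"
  assumes der: "\<And>x. (f has_derivative F x) (at x)"
    and cont: "\<forall>\<^sub>F x in nhds p. \<forall>h. norm (F x h - F p h) \<le> e / 2 * norm h"
  obtains d where "0 < d"
    "\<And>x y. dist x p < d \<Longrightarrow> dist y p < d \<Longrightarrow> norm (f y - f x - F x (y - x)) \<le> e * norm (y - x)"
proof -
  obtain d where d: "0 < d" "\<And>x h. dist x p < d \<Longrightarrow> norm (F x h - F p h) \<le> e / 2 * norm h"
    using cont unfolding eventually_nhds_metric by blast
  have "norm (f y - f x - F x (y - x)) \<le> e * norm (y - x)" if "dist x p < d" "dist y p < d" for x y
  proof -
    have lin: "linear (F p)" using der has_derivative_linear by blast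
    have "norm ((f y - F p y) - (f x - F p x)) \<le> e / 2 * norm (y - x)"
    proof (rule differentiable_bound[OF convex_ball])
      show "((\<lambda>z. f z - F p z) has_derivative (\<lambda>h. F z h - F p h)) (at z within ball p d)" for z
        by (intro has_derivative_diff has_derivative_at_withinI[OF der]
            bounded_linear_imp_has_derivative has_derivative_bounded_linear[OF der])
      show "onorm (\<lambda>h. F z h - F p h) \<le> e / 2" if "z \<in> ball p d" for z
        using d(2) that by (intro onorm_le) (auto simp: dist_commute)
    qed (use that in \<open>auto simp: dist_commute\<close>)
    moreover have "norm (F x (y - x) - F p (y - x)) \<le> e / 2 * norm (y - x)"
      using d(2) that(1) .
    moreover have eq: "f y - f x - F x (y - x) =
        ((f y - F p y) - (f x - F p x)) - (F x (y - x) - F p (y - x))"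
      by (simp add: linear_diff[OF lin])
    ultimately show ?thesis
      using norm_triangle_ineq4[of "(f y - F p y) - (f x - F p x)" "F x (y - x) - F p (y - x)"]
      unfolding eq by linarith
  qed
  with d(1) show thesis using that by blast
qed

text \<open>A short \<open>v\<close> puts \<open>x + v\<close> on the segment from \<open>x\<close>
  to a point at distance 1, where \<open>r\<close> is at most \<open>R\<close>. For a longer
  \<open>v\<close> the bound \<open>R\<close> on the increment is already below
  \<open>R * norm v\<close>.\<close>

lemma convex_increment_le:
  fixes r :: "'a::real_normed_vector \<Rightarrow> real"
  assumes cv: "convex_on UNIV r" and nn: "\<And>z. 0 \<le> r z"
    and R: "\<And>z. norm (z - x) \<le> K \<Longrightarrow> r z \<le> R" and "1 \<le> K" "norm v \<le> K"
  shows "r (x + v) - r x \<le> R * norm v"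
proof (cases "v = 0")
  case v: False
  have R0: "0 \<le> R" using R[of x] nn[of x] assms(4) by simp
  show ?thesis
  proof (cases "norm v \<le> 1")
    case True
    have "r ((1 - norm v) *\<^sub>R x + norm v *\<^sub>R (x + v /\<^sub>R norm v))
        \<le> (1 - norm v) * r x + norm v * r (x + v /\<^sub>R norm v)"
      by (rule convex_onD[OF cv]) (use True in auto)
    moreover have "(1 - norm v) *\<^sub>R x + norm v *\<^sub>R (x + v /\<^sub>R norm v) = x + v"
      using v by (simp add: algebra_simps)
    moreover have "norm v * r (x + v /\<^sub>R norm v) \<le> norm v * R"
      using v assms(4) by (intro mult_left_mono R) auto
    moreover have "0 \<le> norm v * r x" by (simp add: nn)
    ultimately show ?thesis by (simp add: algebra_simps)
  next
    case False
    have "r (x + v) - r x \<le> R" using R[of "x + v"] nn[of x] assms(5) by simp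
    also have "R * 1 \<le> R * norm v" using False R0 by (intro mult_left_mono) auto
    finally show ?thesis by simp
  qed
qed simp

text \<open>The quantity \<open>A\<close> of \<open>tau_trial\<close>: the proximal model of the
  change of \<open>f + r\<close> along \<open>s\<close>.\<close>

definition obj_model ::
  "(real ^ 'n \<Rightarrow> real) \<Rightarrow> (real ^ 'n \<Rightarrow> real) \<Rightarrow> real ^ 'n \<Rightarrow> real \<Rightarrow> real ^ 'n \<Rightarrow> real" where
  "obj_model f r x \<alpha> s = gradient f x \<bullet> s + 1 / (2 * \<alpha>) * (norm s)\<^sup>2 + r (x + s) - r x"

text \<open>Up to a constant, the tangential objective at \<open>u\<close> is \<open>obj_model\<close> at \<open>s = v + u\<close>; hence \<open>s\<close>
  depends on \<open>v\<close> only through \<open>Jac c x *v v\<close>.\<close>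
lemma tangential_step_optimal:
  assumes ts: "tangential_step f r c x \<alpha> v u" and \<alpha>: "0 < \<alpha>"
  shows "Jac c x *v u = 0" "x + (v + u) \<in> Omega"
    and "Jac c x *v s = Jac c x *v v \<Longrightarrow> x + s \<in> Omega \<Longrightarrow> obj_model f r x \<alpha> (v + u) \<le> obj_model f r x \<alpha> s"
proof -
  let ?q = "\<lambda>w. gradient f x \<bullet> w + 1 / (2 * \<alpha>) * (norm w)\<^sup>2 + 1 / \<alpha> * (v \<bullet> w) + r (x + v + w)"
  have q: "?q w = obj_model f r x \<alpha> (v + w) + (r x - gradient f x \<bullet> v - 1 / (2 * \<alpha>) * (norm v)\<^sup>2)" for w
    unfolding obj_model_def power2_norm_eq_inner using \<alpha>
    by (simp add: inner_add inner_commute field_simps)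
  show "Jac c x *v u = 0" "x + (v + u) \<in> Omega"
    using ts by (auto simp: tangential_step_def is_arg_min_def add.assoc)
  assume s: "Jac c x *v s = Jac c x *v v" "x + s \<in> Omega"
  then have "Jac c x *v (s - v) = 0 \<and> x + v + (s - v) \<in> Omega"
    by (simp add: matrix_vector_mult_diff_distrib)
  then have "?q u \<le> ?q (s - v)"
    using ts unfolding tangential_step_def is_arg_min_linorder by blast
  then show "obj_model f r x \<alpha> (v + u) \<le> obj_model f r x \<alpha> s" unfolding q by simp
qed

lemma lin_decrease_tangential:
  "Jac c x *v u = 0 \<Longrightarrow> lin_decrease c x (v + u) = lin_decrease c x v"
  by (simp add: lin_decrease_def matrix_vector_right_distrib)

section \<open>Estimates for a single iteration near a fixed point\<close>

locale problem =
  fixes f r :: "real ^ 'n \<Rightarrow> real" and c :: "real ^ 'n \<Rightarrow> real ^ 'm" and P :: "'n inputs"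
  assumes f_diff: "f differentiable_on UNIV" and grad_cont: "continuous_on UNIV (gradient f)"
    and c_diff: "c differentiable_on UNIV" and Jac_cont: "continuous_on UNIV (Jac c)"
    and r_convex: "convex_on UNIV r" and r_nonneg: "\<And>p. 0 \<le> r p"
    and inputs: "valid_inputs P"
begin

lemma isCont_grad: "isCont (gradient f) p"
  using grad_cont by (simp add: continuous_on_eq_continuous_at)

lemma isCont_Jac: "isCont (Jac c) p"
  using Jac_cont by (simp add: continuous_on_eq_continuous_at)

lemma isCont_c: "isCont c p"
  using differentiable_imp_continuous_on[OF c_diff] by (simp add: continuous_on_eq_continuous_at)

lemma isCont_r: "isCont r p"
  using convex_on_continuous[OF open_UNIV r_convex] by (simp add: continuous_on_eq_continuous_at)

text \<open>Continuity of the gradient at \<open>p\<close> is what \<open>strict_derivative\<close>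
  asks for. The two points only have to be close to \<open>p\<close>, so one of them may be a trial
  point.\<close>

lemma f_strict:
  assumes "0 < e"
  obtains d where "0 < d"
    "\<And>x y. dist x p < d \<Longrightarrow> dist y p < d \<Longrightarrow> norm (f y - f x - (y - x) \<bullet> gradient f x) \<le> e * norm (y - x)"
proof (rule strict_derivative[of f "\<lambda>x h. h \<bullet> gradient f x" p e])
  show "(f has_derivative (\<lambda>h. h \<bullet> gradient f x)) (at x)" for x
    using GDERIV_gradient[of f x] f_diff unfolding gderiv_def differentiable_on_def by simp
  have "\<forall>\<^sub>F x in nhds p. dist (gradient f x) (gradient f p) < e / 2"
    by (rule tendstoD[OF isCont_nhds[OF isCont_grad]]) (use assms in simp)
  then show "\<forall>\<^sub>F x in nhds p. \<forall>h. norm (h \<bullet> gradient f x - h \<bullet> gradient f p) \<le> e / 2 * norm h"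
  proof eventually_elim
    case (elim x)
    show ?case
    proof
      fix h
      have "norm (h \<bullet> gradient f x - h \<bullet> gradient f p) \<le> norm (gradient f x - gradient f p) * norm h"
        using Cauchy_Schwarz_ineq2[of h "gradient f x - gradient f p"]
        by (simp add: inner_diff_right mult.commute)
      also have "\<dots> \<le> e / 2 * norm h" using elim by (intro mult_right_mono) (auto simp: dist_norm)
      finally show "norm (h \<bullet> gradient f x - h \<bullet> gradient f p) \<le> e / 2 * norm h" .
    qed
  qed
qed (use that in blast)

lemma c_strict:
  assumes "0 < e"
  obtains d where "0 < d"
    "\<And>x y. dist x p < d \<Longrightarrow> dist y p < d \<Longrightarrow> norm (c y - c x - Jac c x *v (y - x)) \<le> e * norm (y - x)"
proof (rule strict_derivative[of c "\<lambda>x h. Jac c x *v h" p e])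
  show "(c has_derivative (\<lambda>h. Jac c x *v h)) (at x)" for x
    using c_diff jacobian_works[of c "at x"] unfolding differentiable_on_def by simp
  have "\<forall>\<^sub>F x in nhds p. dist (Jac c x) (Jac c p) < e / 2"
    by (rule tendstoD[OF isCont_nhds[OF isCont_Jac]]) (use assms in simp)
  then show "\<forall>\<^sub>F x in nhds p. \<forall>h. norm (Jac c x *v h - Jac c p *v h) \<le> e / 2 * norm h"
  proof eventually_elim
    case (elim x)
    show ?case
    proof
      fix h
      have "norm (Jac c x *v h - Jac c p *v h) \<le> norm (Jac c x - Jac c p) * norm h"
        using norm_matrix_vector_le[of "Jac c x - Jac c p" h]
        by (simp add: matrix_vector_mult_diff_rdistrib)
      also have "\<dots> \<le> e / 2 * norm h" using elim by (intro mult_right_mono) (auto simp: dist_norm)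
      finally show "norm (Jac c x *v h - Jac c p *v h) \<le> e / 2 * norm h" .
    qed
  qed
qed (use that in blast)

lemma eventually_norm_bounded:
  assumes "isCont (h :: 'a::t2_space \<Rightarrow> 'b::real_normed_vector) p"
  shows "\<forall>\<^sub>F x in nhds p. norm (h x) < norm (h p) + 1"
  by (rule order_tendstoD(2)[OF tendsto_norm[OF isCont_nhds[OF assms]]]) simp

lemma r_bounded_near:
  obtains R where "0 \<le> R" "\<And>z. norm (z - p) \<le> K \<Longrightarrow> r z \<le> R"
proof -
  have "compact (r ` cball p K)"
    using isCont_r by (intro compact_continuous_image compact_cball continuous_at_imp_continuous_on) auto
  then obtain R where R: "\<And>z. z \<in> cball p K \<Longrightarrow> norm (r z) \<le> R"
    using compact_imp_bounded bounded_iff by (metis imageI)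
  then have "r z \<le> \<bar>R\<bar>" if "norm (z - p) \<le> K" for z
  proof -
    have "norm (r z) \<le> R" using that by (intro R) (simp add: dist_norm norm_minus_commute)
    then show ?thesis by simp
  qed
  then show thesis using that[of "\<bar>R\<bar>"] by simp
qed

text \<open>The length bound follows from \<open>delta c x \<le> norm (feas_grad c x)\<close>. In
  the model the gradient term is linear in \<open>norm v\<close>, the proximal term is too because
  \<open>norm v\<close> is of order \<open>\<alpha>\<close>, and convexity bounds the increment of
  \<open>r\<close>.\<close>

lemma normal_step_bounds:
  assumes a0: "0 < a0"
  obtains K where "0 < K"
    "\<forall>\<^sub>F x in nhds p. \<forall>\<alpha> v. x \<in> Omega \<longrightarrow> 0 < \<alpha> \<longrightarrow> \<alpha> \<le> a0 \<longrightarrow> normal_step P c x \<alpha> v \<longrightarrow>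
       norm v \<le> K * \<alpha> * norm (c x) \<and> obj_model f r x \<alpha> v \<le> K * norm v"
proof -
  define M where "M = norm (Jac c p) + 1"
  define N where "N = norm (c p) + 1"
  define G where "G = norm (gradient f p) + 1"
  have pos: "0 < M" "0 < N" "0 < G" by (simp_all add: M_def N_def G_def add_nonneg_pos)
  have \<kappa>: "0 < kappa_v P" using inputs by (simp add: valid_inputs_def)
  \<comment> \<open>\<open>K0\<close> bounds all normal steps with \<open>\<alpha> \<le> a0\<close>;
    the radius \<open>K0 + 1\<close> below allows for \<open>x\<close> at distance up to 1 from
    \<open>p\<close>.\<close>
  define K0 where "K0 = max 1 (kappa_v P * a0 * (M * N))"
  then have K01: "1 \<le> K0" by simp
  obtain R where R: "0 \<le> R" "\<And>z. norm (z - p) \<le> K0 + 1 \<Longrightarrow> r z \<le> R"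
    using r_bounded_near[of p "K0 + 1"] by blast
  define K where "K = max (kappa_v P * M) (G + kappa_v P * (M * N) / 2 + R)"
  have "0 < K" unfolding K_def using \<kappa> pos by (simp add: less_max_iff_disj)
  have "\<forall>\<^sub>F x in nhds p. dist x p < 1" unfolding eventually_nhds_metric by (rule exI[of _ 1]) simp
  with eventually_norm_bounded[OF isCont_Jac[of p]] eventually_norm_bounded[OF isCont_c[of p]]
    eventually_norm_bounded[OF isCont_grad[of p]]
  have "\<forall>\<^sub>F x in nhds p. \<forall>\<alpha> v. x \<in> Omega \<longrightarrow> 0 < \<alpha> \<longrightarrow> \<alpha> \<le> a0 \<longrightarrow> normal_step P c x \<alpha> v \<longrightarrow>
       norm v \<le> K * \<alpha> * norm (c x) \<and> obj_model f r x \<alpha> v \<le> K * norm v"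
  proof eventually_elim
    case (elim x)
    note b = elim(1-3)[folded M_def N_def G_def]
    show ?case
    proof (intro allI impI)
      fix \<alpha> v assume x: "x \<in> Omega" and \<alpha>: "0 < \<alpha>" "\<alpha> \<le> a0" and ns: "normal_step P c x \<alpha> v"
      have \<delta>: "delta c x \<le> M * norm (c x)"
      proof -
        have "delta c x \<le> norm (Jac c x) * norm (c x)"
          using delta_le[OF x, of c] norm_transpose_vector_le[of "Jac c x" "c x"]
          unfolding feas_grad_def by linarith
        also have "\<dots> \<le> M * norm (c x)" using b by (intro mult_right_mono) auto
        finally show ?thesis .
      qed
      then have \<delta>D: "delta c x \<le> M * N"
        using b(2) pos by (smt (verit) mult_left_mono)
      have v1: "norm v \<le> kappa_v P * \<alpha> * delta c x"
        using ns by (cases "delta c x = 0") (auto simp: normal_step_def)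
      also have "\<dots> \<le> kappa_v P * \<alpha> * (M * norm (c x))"
        using \<kappa> \<alpha> \<delta> by (intro mult_left_mono) auto
      also have "\<dots> = kappa_v P * M * (\<alpha> * norm (c x))" by simp
      also have "\<dots> \<le> K * (\<alpha> * norm (c x))"
        using \<alpha> by (intro mult_right_mono) (auto simp: K_def)
      finally have v2: "norm v \<le> K * \<alpha> * norm (c x)" by (simp add: ac_simps)
      have "kappa_v P * \<alpha> * delta c x \<le> kappa_v P * a0 * (M * N)"
        using \<kappa> \<alpha> \<delta>D pos by (intro mult_mono) (auto simp: delta_nonneg)
      then have vK: "norm v \<le> K0" using v1 by (simp add: K0_def)
      have "r z \<le> R" if "norm (z - x) \<le> K0" for z
        using R(2)[of z] norm_triangle_ineq[of "z - x" "x - p"] that elim(4)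
        by (simp add: dist_norm)
      then have rv: "r (x + v) - r x \<le> R * norm v"
        by (rule convex_increment_le[OF r_convex r_nonneg _ K01 vK])
      have "gradient f x \<bullet> v \<le> norm (gradient f x) * norm v" by (rule norm_cauchy_schwarz)
      also have "\<dots> \<le> G * norm v" using b by (intro mult_right_mono) auto
      finally have gv: "gradient f x \<bullet> v \<le> G * norm v" .
      have "norm v * norm v \<le> (kappa_v P * \<alpha> * (M * N)) * norm v"
      proof (intro mult_right_mono)
        show "norm v \<le> kappa_v P * \<alpha> * (M * N)"
          using v1 \<delta>D \<kappa> \<alpha> by (smt (verit) mult_left_mono mult_pos_pos)
      qed simp
      then have "1 / (2 * \<alpha>) * (norm v)\<^sup>2 \<le> 1 / (2 * \<alpha>) * ((kappa_v P * \<alpha> * (M * N)) * norm v)"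
        using \<alpha> by (intro mult_left_mono) (auto simp: power2_eq_square)
      also have "\<dots> = kappa_v P * (M * N) / 2 * norm v" using \<alpha> by simp
      finally have "obj_model f r x \<alpha> v \<le> (G + kappa_v P * (M * N) / 2 + R) * norm v"
        using gv rv unfolding obj_model_def by (simp add: distrib_right)
      also have "\<dots> \<le> K * norm v" by (intro mult_right_mono) (auto simp: K_def)
      finally show "norm v \<le> K * \<alpha> * norm (c x) \<and> obj_model f r x \<alpha> v \<le> K * norm v" using v2 by simp
    qed
  qed
  with \<open>0 < K\<close> show thesis using that by blast
qed

text \<open>Free of the iteration index, so that estimates near \<open>p\<close> are uniform in
  \<open>\<alpha>\<close>, \<open>v\<close> and \<open>u\<close> and apply along any
  subsequence.\<close>

definition iteration :: "real ^ 'n \<Rightarrow> real \<Rightarrow> real ^ 'n \<Rightarrow> real ^ 'n \<Rightarrow> bool" where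
  "iteration x \<alpha> v u \<longleftrightarrow> x \<in> Omega \<and> 0 < \<alpha> \<and> \<alpha> \<le> alpha_init P \<and> x + v \<in> Omega \<and>
     normal_step P c x \<alpha> v \<and> \<not> stops_infeasible c x \<and> tangential_step f r c x \<alpha> v u"

lemma alpha_init_pos: "0 < alpha_init P"
  using inputs by (simp add: valid_inputs_def)

text \<open>The comparison of the two model values uses the zero tangential step, which is
  admissible because \<open>x + v\<close> lies in \<open>Omega\<close>.\<close>

lemma iteration_facts:
  assumes "iteration x \<alpha> v u"
  shows "Jac c x *v u = 0" "x + (v + u) \<in> Omega" "obj_model f r x \<alpha> (v + u) \<le> obj_model f r x \<alpha> v"
    "lin_decrease c x (v + u) = lin_decrease c x v" "0 \<le> lin_decrease c x (v + u)"
  using tangential_step_optimal(1,2)[of f r c x \<alpha> v u] tangential_step_optimal(3)[of f r c x \<alpha> v u v] lin_decrease_tangential[of c x u v]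
    normal_step_decrease_pos(1)[OF _ inputs, of x \<alpha> c v] assms
  by (simp_all add: iteration_def)

text \<open>A positive model value is at most of order \<open>norm v\<close>, hence of order
  \<open>\<alpha> * norm (c x)\<close>, which LICQ bounds by the linearized decrease. This keeps the
  trial values of \<open>\<tau>\<close> away from zero near \<open>p\<close>.\<close>

lemma iteration_obj_model_le:
  assumes "licq c p" "p \<in> Omega"
  obtains C where "0 < C"
    "\<forall>\<^sub>F x in nhds p. \<forall>\<alpha> v u. iteration x \<alpha> v u \<longrightarrow>
       C * obj_model f r x \<alpha> (v + u) \<le> lin_decrease c x (v + u)"
proof -
  obtain C where C: "0 < C" and ev1: "\<forall>\<^sub>F x in nhds p. \<forall>\<alpha> v. x \<in> Omega \<longrightarrow> 0 < \<alpha> \<longrightarrow> \<alpha> \<le> alpha_init P \<longrightarrow>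
      normal_step P c x \<alpha> v \<longrightarrow> \<not> stops_infeasible c x \<longrightarrow> C * \<alpha> * norm (c x) \<le> lin_decrease c x v"
    using licq_normal_decrease[OF assms isCont_Jac isCont_c inputs alpha_init_pos] by blast
  obtain K where K: "0 < K" and ev2: "\<forall>\<^sub>F x in nhds p. \<forall>\<alpha> v. x \<in> Omega \<longrightarrow> 0 < \<alpha> \<longrightarrow> \<alpha> \<le> alpha_init P \<longrightarrow>
      normal_step P c x \<alpha> v \<longrightarrow> norm v \<le> K * \<alpha> * norm (c x) \<and> obj_model f r x \<alpha> v \<le> K * norm v"
    using normal_step_bounds[OF alpha_init_pos] by blast
  have "\<forall>\<^sub>F x in nhds p. \<forall>\<alpha> v u. iteration x \<alpha> v u \<longrightarrow>
       C / K\<^sup>2 * obj_model f r x \<alpha> (v + u) \<le> lin_decrease c x (v + u)"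
    using ev1 ev2
  proof eventually_elim
    case (elim x)
    show ?case
    proof (intro allI impI)
      fix \<alpha> v u assume it: "iteration x \<alpha> v u"
      then have s: "x \<in> Omega" "0 < \<alpha>" "\<alpha> \<le> alpha_init P" "normal_step P c x \<alpha> v" "\<not> stops_infeasible c x"
        by (auto simp: iteration_def)
      have "obj_model f r x \<alpha> (v + u) \<le> K * norm v"
        using iteration_facts(3)[OF it] elim(2) s by (meson order_trans)
      also have "\<dots> \<le> K * (K * \<alpha> * norm (c x))"
        using elim(2) s K by (intro mult_left_mono) auto
      finally have "C / K\<^sup>2 * obj_model f r x \<alpha> (v + u) \<le> C / K\<^sup>2 * (K * (K * \<alpha> * norm (c x)))"
        using C K by (intro mult_left_mono) auto
      also have "\<dots> = C * \<alpha> * norm (c x)" using K by (simp add: power2_eq_square)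
      also have "\<dots> \<le> lin_decrease c x (v + u)"
        using elim(1) s iteration_facts(4)[OF it] by simp
      finally show "C / K\<^sup>2 * obj_model f r x \<alpha> (v + u) \<le> lin_decrease c x (v + u)" .
    qed
  qed
  moreover have "0 < C / K\<^sup>2" using C K by simp
  ultimately show thesis using that by blast
qed

text \<open>A small \<open>\<alpha>\<close> forces a short step, so the trial point is close to
  \<open>p\<close> and the linearization errors are at most \<open>\<omega> * norm s\<close>. As
  \<open>norm s \<ge> \<epsilon> * \<alpha>\<close>, half of the proximal term absorbs these
  errors.\<close>

lemma iteration_sufficient_decrease:
  assumes T: "0 < T" and \<epsilon>: "0 < \<epsilon>"
  obtains a where "0 < a"
    "\<forall>\<^sub>F x in nhds p. \<forall>\<alpha> v u. iteration x \<alpha> v u \<longrightarrow> \<alpha> \<le> a \<longrightarrow>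
       T * obj_model f r x \<alpha> (v + u) \<le> (1 - sigma_c P) * lin_decrease c x (v + u) \<longrightarrow>
       \<epsilon> * \<alpha> \<le> norm (v + u) \<longrightarrow> sufficient_decrease P f r c x \<alpha> T (v + u)"
proof -
  obtain K where K: "0 < K" and ev2: "\<forall>\<^sub>F x in nhds p. \<forall>\<alpha> v. x \<in> Omega \<longrightarrow> 0 < \<alpha> \<longrightarrow> \<alpha> \<le> alpha_init P \<longrightarrow>
      normal_step P c x \<alpha> v \<longrightarrow> norm v \<le> K * \<alpha> * norm (c x) \<and> obj_model f r x \<alpha> v \<le> K * norm v"
    using normal_step_bounds[OF alpha_init_pos] by blast
  \<comment> \<open>Chosen so that \<open>(T + 1) * \<omega> = T * \<epsilon> / 4\<close>;
    \<open>f\<close> contributes the factor \<open>T\<close> and \<open>c\<close> the factor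
    1.\<close>
  define \<omega> where "\<omega> = T * \<epsilon> / (4 * (T + 1))"
  have \<omega>: "0 < \<omega>" using T \<epsilon> by (simp add: \<omega>_def)
  obtain d1 where d1: "0 < d1" "\<And>x y. dist x p < d1 \<Longrightarrow> dist y p < d1 \<Longrightarrow>
      norm (f y - f x - (y - x) \<bullet> gradient f x) \<le> \<omega> * norm (y - x)"
    using f_strict[OF \<omega>] by blast
  obtain d2 where d2: "0 < d2" "\<And>x y. dist x p < d2 \<Longrightarrow> dist y p < d2 \<Longrightarrow>
      norm (c y - c x - Jac c x *v (y - x)) \<le> \<omega> * norm (y - x)"
    using c_strict[OF \<omega>] by blast
  define d where "d = min 1 (min d1 d2)"
  have d: "0 < d" "d \<le> d1" "d \<le> d2" "d \<le> 1" using d1 d2 by (auto simp: d_def)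
  define N where "N = norm (c p) + 1"
  define G where "G = norm (gradient f p) + 1"
  define R where "R = norm (r p) + 1"
  have pos: "0 < N" "0 < G" "0 < R" by (simp_all add: N_def G_def R_def add_nonneg_pos)
  \<comment> \<open>The model bound will give
    \<open>(norm s)\<^sup>2 \<le> 2 * \<alpha> * H * (1 + norm s)\<close>. With
    \<open>\<alpha> \<le> a\<close> the factor \<open>2 * \<alpha> * H\<close> is at most
    \<open>(d / 2)\<^sup>2 / 2\<close>.\<close>
  define H where "H = K * K * alpha_init P * N + G + R"
  have H: "0 < H" using pos K alpha_init_pos by (simp add: H_def add_pos_pos)
  define a where "a = (d / 2)\<^sup>2 / (4 * H)"
  have a: "0 < a" using d H by (simp add: a_def)
  have "\<forall>\<^sub>F x in nhds p. dist x p < d / 2" unfolding eventually_nhds_metric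
    by (rule exI[of _ "d / 2"]) (use d in simp)
  with eventually_norm_bounded[OF isCont_c[of p]]
    eventually_norm_bounded[OF isCont_grad[of p]] eventually_norm_bounded[OF isCont_r[of p]] ev2
  have "\<forall>\<^sub>F x in nhds p. \<forall>\<alpha> v u. iteration x \<alpha> v u \<longrightarrow> \<alpha> \<le> a \<longrightarrow>
       T * obj_model f r x \<alpha> (v + u) \<le> (1 - sigma_c P) * lin_decrease c x (v + u) \<longrightarrow>
       \<epsilon> * \<alpha> \<le> norm (v + u) \<longrightarrow> sufficient_decrease P f r c x \<alpha> T (v + u)"
  proof eventually_elim
    case (elim x)
    note b = elim(1-3)[folded N_def G_def R_def]
    show ?case
    proof (intro allI impI)
      fix \<alpha> v u assume it: "iteration x \<alpha> v u" and \<alpha>a: "\<alpha> \<le> a" and \<epsilon>\<alpha>: "\<epsilon> * \<alpha> \<le> norm (v + u)"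
        and trial: "T * obj_model f r x \<alpha> (v + u) \<le> (1 - sigma_c P) * lin_decrease c x (v + u)"
      have st: "x \<in> Omega" "0 < \<alpha>" "\<alpha> \<le> alpha_init P" "normal_step P c x \<alpha> v"
        using it by (auto simp: iteration_def)
      let ?s = "v + u"
      have "obj_model f r x \<alpha> ?s \<le> K * norm v"
        using iteration_facts(3)[OF it] elim(4) st by (meson order_trans)
      also have "\<dots> \<le> K * (K * \<alpha> * norm (c x))"
        using elim(4) st K by (intro mult_left_mono) auto
      also have "\<dots> \<le> K * (K * alpha_init P * N)"
        using st K b pos by (intro mult_left_mono mult_mono) auto
      finally have "1 / (2 * \<alpha>) * (norm ?s)\<^sup>2 \<le> K * K * alpha_init P * N + r x - gradient f x \<bullet> ?s"
        using r_nonneg[of "x + ?s"] unfolding obj_model_def by simp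
      moreover have "- (gradient f x \<bullet> ?s) \<le> G * norm ?s"
      proof -
        have "\<bar>gradient f x \<bullet> ?s\<bar> \<le> norm (gradient f x) * norm ?s" by (rule Cauchy_Schwarz_ineq2)
        also have "\<dots> \<le> G * norm ?s" using b by (intro mult_right_mono) auto
        finally show ?thesis by linarith
      qed
      moreover have "r x \<le> R" using b(3) by simp
      ultimately have "1 / (2 * \<alpha>) * (norm ?s)\<^sup>2 \<le> K * K * alpha_init P * N + R + G * norm ?s" by linarith
      also have "\<dots> \<le> H * (1 + norm ?s)"
      proof -
        have "0 \<le> (K * K * alpha_init P * N + R) * norm ?s"
          using K pos alpha_init_pos by (intro mult_nonneg_nonneg add_nonneg_nonneg) auto
        then show ?thesis using pos by (simp add: H_def algebra_simps)
      qed
      finally have "(norm ?s)\<^sup>2 \<le> 2 * \<alpha> * (H * (1 + norm ?s))" using st(2) by (simp add: field_simps)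
      also have "\<dots> \<le> 2 * a * (H * (1 + norm ?s))"
        using \<alpha>a H by (intro mult_right_mono) auto
      also have "\<dots> = (d / 2)\<^sup>2 / 2 * (1 + norm ?s)" using H by (simp add: a_def)
      finally have sq: "(norm ?s)\<^sup>2 \<le> (d / 2)\<^sup>2 / 2 * (1 + norm ?s)" .
      \<comment> \<open>Were the step longer than \<open>d / 2\<close>, then, since
        \<open>d \<le> 1\<close>, the first summand on the right of \<open>sq\<close> would be less
        than half of \<open>(norm ?s)\<^sup>2\<close> and the second at most half.\<close>
      have sd: "norm ?s \<le> d / 2"
      proof (rule ccontr)
        assume "\<not> norm ?s \<le> d / 2"
        then have lt: "d / 2 < norm ?s" by simp
        then have "(d / 2)\<^sup>2 < (norm ?s)\<^sup>2" using d by (intro power_strict_mono) auto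
        moreover have "(d / 2)\<^sup>2 * norm ?s \<le> (norm ?s)\<^sup>2"
        proof -
          have "(d / 2)\<^sup>2 = d / 2 * (d / 2)" by (simp add: power2_eq_square)
          also have "\<dots> \<le> norm ?s * 1" using lt d by (intro mult_mono) auto
          finally show ?thesis unfolding power2_eq_square[of "norm ?s"] by (intro mult_right_mono) auto
        qed
        ultimately show False using sq by (simp add: distrib_left)
      qed
      have near: "dist x p < d" "dist (x + ?s) p < d"
        using elim(5) sd d norm_triangle_ineq[of "x - p" ?s] by (auto simp: dist_norm algebra_simps)
      have "norm (f (x + ?s) - f x - ?s \<bullet> gradient f x) \<le> \<omega> * norm ?s"
        using d1(2)[of x "x + ?s"] near d by simp
      then have fs: "f (x + ?s) - f x \<le> gradient f x \<bullet> ?s + \<omega> * norm ?s" by (simp add: inner_commute)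
      have "norm (c (x + ?s) - c x - Jac c x *v ?s) \<le> \<omega> * norm ?s"
        using d2(2)[of x "x + ?s"] near d by simp
      then have cs: "norm (c (x + ?s)) - norm (c x) \<le> \<omega> * norm ?s - lin_decrease c x ?s"
        using norm_triangle_ineq[of "c x + Jac c x *v ?s" "c (x + ?s) - c x - Jac c x *v ?s"]
        by (simp add: lin_decrease_def)
      have \<Delta>: "0 \<le> lin_decrease c x ?s" using iteration_facts(5)[OF it] .
      have "T * (f (x + ?s) - f x + r (x + ?s) - r x)
          \<le> T * (obj_model f r x \<alpha> ?s - 1 / (2 * \<alpha>) * (norm ?s)\<^sup>2 + \<omega> * norm ?s)"
        using T fs by (intro mult_left_mono) (auto simp: obj_model_def)
      then have "merit f r c T (x + ?s) - merit f r c T x \<le>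
          - sigma_c P * lin_decrease c x ?s - T / (2 * \<alpha>) * (norm ?s)\<^sup>2 + (T + 1) * \<omega> * norm ?s"
        using cs trial unfolding merit_def by (simp add: algebra_simps)
      moreover have "(T + 1) * \<omega> * norm ?s \<le> T / (4 * \<alpha>) * (norm ?s)\<^sup>2"
      proof -
        have *: "\<epsilon> * norm ?s \<le> norm ?s / \<alpha> * norm ?s"
          using \<epsilon>\<alpha> st(2) by (intro mult_right_mono) (auto simp: field_simps)
        have "(T + 1) * \<omega> = T / 4 * \<epsilon>" using T by (simp add: \<omega>_def field_simps)
        then have "(T + 1) * \<omega> * norm ?s = T / 4 * (\<epsilon> * norm ?s)" by simp
        also have "\<dots> \<le> T / 4 * (norm ?s / \<alpha> * norm ?s)"
          using T * by (intro mult_left_mono) auto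
        also have "\<dots> = T / (4 * \<alpha>) * (norm ?s)\<^sup>2" by (simp add: power2_eq_square)
        finally show ?thesis .
      qed
      moreover have "T / (2 * \<alpha>) * (norm ?s)\<^sup>2 = 2 * (T / (4 * \<alpha>) * (norm ?s)\<^sup>2)" by simp
      ultimately have "merit f r c T (x + ?s) - merit f r c T x \<le>
          - (T / (4 * \<alpha>) * (norm ?s)\<^sup>2 + sigma_c P * lin_decrease c x ?s)" by simp
      also have "\<dots> \<le> - eta_Phi P * (T / (4 * \<alpha>) * (norm ?s)\<^sup>2 + sigma_c P * lin_decrease c x ?s)"
      proof -
        have "0 \<le> T / (4 * \<alpha>) * (norm ?s)\<^sup>2 + sigma_c P * lin_decrease c x ?s"
          using T st(2) \<Delta> inputs by (auto simp: valid_inputs_def)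
        moreover have "eta_Phi P \<le> 1" using inputs by (simp add: valid_inputs_def)
        ultimately show ?thesis using mult_right_mono by fastforce
      qed
      finally show "sufficient_decrease P f r c x \<alpha> T ?s" unfolding sufficient_decrease_def .
    qed
  qed
  with a show thesis using that by blast
qed

end

section \<open>Vanishing steps lead to KKT points\<close>

text \<open>Separation of the origin from the set of attainable constraint residuals and objective
  increases; LICQ makes the multiplier of the objective nonzero.\<close>
lemma licq_multipliers:
  fixes c :: "real ^ 'n \<Rightarrow> real ^ 'm"
  assumes licq: "licq c p" and cv: "convex_on UNIV \<phi>" and \<phi>0: "\<phi> 0 = 0"
    and opt: "\<And>t. Jac c p *v t = 0 \<Longrightarrow> (\<And>i. p $ i = 0 \<Longrightarrow> 0 \<le> t $ i) \<Longrightarrow> 0 \<le> \<phi> t"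
  obtains y z where "\<And>t. 0 \<le> \<phi> t + y \<bullet> (Jac c p *v t) + z \<bullet> t"
    "\<And>i. z $ i \<le> 0" "\<And>i. p $ i \<noteq> 0 \<Longrightarrow> z $ i = 0"
proof -
  let ?J = "Jac c p"
  \<comment> \<open>The strict bound on \<open>e\<close> excludes the origin by optimality. Entries
    of \<open>b\<close> at inactive coordinates are free, which will force the corresponding
    multipliers to vanish.\<close>
  define E where "E = {(a, b, e) | a b (e::real). \<exists>t. a = ?J *v t \<and> (\<forall>i. p $ i = 0 \<longrightarrow> b $ i \<le> t $ i) \<and> \<phi> t < e}"
  have "convex E"
  proof (rule convexI)
    fix w1 w2 and k l :: real assume w: "w1 \<in> E" "w2 \<in> E" and kl: "0 \<le> k" "0 \<le> l" "k + l = 1"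
    obtain b1 e1 t1 where 1: "w1 = (?J *v t1, b1, e1)" "\<And>i. p $ i = 0 \<Longrightarrow> b1 $ i \<le> t1 $ i" "\<phi> t1 < e1"
      using w(1) unfolding E_def by blast
    obtain b2 e2 t2 where 2: "w2 = (?J *v t2, b2, e2)" "\<And>i. p $ i = 0 \<Longrightarrow> b2 $ i \<le> t2 $ i" "\<phi> t2 < e2"
      using w(2) unfolding E_def by blast
    define t where "t = k *\<^sub>R t1 + l *\<^sub>R t2"
    have "\<phi> t \<le> k * \<phi> t1 + l * \<phi> t2"
      using cv kl unfolding t_def convex_on_def by blast
    also have "\<dots> < k * e1 + l * e2"
    proof (cases "k = 0")
      case False
      then have "k * \<phi> t1 < k * e1" using 1(3) kl by simp
      moreover have "l * \<phi> t2 \<le> l * e2" using 2(3) kl by (intro mult_left_mono) auto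
      ultimately show ?thesis by linarith
    qed (use 2(3) kl in simp)
    finally have "\<phi> t < k * e1 + l * e2" .
    moreover have "?J *v t = k *\<^sub>R (?J *v t1) + l *\<^sub>R (?J *v t2)"
      by (simp add: t_def matrix_vector_right_distrib matrix_vector_mult_scaleR)
    moreover have "(k *\<^sub>R b1 + l *\<^sub>R b2) $ i \<le> t $ i" if "p $ i = 0" for i
      using 1(2)[OF that] 2(2)[OF that] kl by (simp add: t_def add_mono mult_left_mono)
    ultimately show "k *\<^sub>R w1 + l *\<^sub>R w2 \<in> E"
      unfolding E_def 1(1) 2(1) by (auto intro!: exI[of _ t])
  qed
  moreover have "0 \<notin> E"
  proof
    assume "0 \<in> E"
    then obtain t where "?J *v t = 0" "\<And>i. p $ i = 0 \<Longrightarrow> 0 \<le> t $ i" "\<phi> t < 0"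
      unfolding E_def zero_prod_def by auto
    with opt[of t] show False by simp
  qed
  ultimately obtain w where "w \<noteq> 0" and w: "\<And>q. q \<in> E \<Longrightarrow> 0 \<le> w \<bullet> q"
    using separating_hyperplane_set_0[of E] by blast
  obtain y z \<mu> where yz: "w = (y, z, \<mu>)" by (cases w) auto
  have sep: "0 \<le> y \<bullet> (?J *v t) + z \<bullet> b + \<mu> * e"
    if "\<And>i. p $ i = 0 \<Longrightarrow> b $ i \<le> t $ i" "\<phi> t < e" for t b e
  proof -
    have "(?J *v t, b, e) \<in> E" unfolding E_def using that by blast
    then show ?thesis using w[of "(?J *v t, b, e)"] by (simp add: yz add.assoc)
  qed
  have \<mu>: "0 \<le> \<mu>" using sep[of 0 0 1] \<phi>0 by simp
  \<comment> \<open>Test with \<open>t = 0\<close> and one nonzero entry of \<open>b\<close>: it may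
    be any number at an inactive coordinate and any nonpositive number at an active one. Large
    entries then fix the signs of \<open>z\<close>.\<close>
  have tilt: "0 \<le> M * z $ i + \<mu>" if "M \<le> 0 \<or> p $ i \<noteq> 0" for M i
  proof -
    have "axis i M $ k \<le> (0 :: real ^ 'n) $ k" if "p $ k = 0" for k
      using \<open>M \<le> 0 \<or> p $ i \<noteq> 0\<close> that by (auto simp: axis_def)
    then show ?thesis using sep[of "axis i M" 0 1] \<phi>0 by (simp add: inner_axis mult.commute)
  qed
  have unb: "z $ i = 0" if "\<And>M. 0 \<le> M * z $ i + \<mu>" for i
  proof (rule ccontr)
    assume "z $ i \<noteq> 0"
    then show False using that[of "- (\<mu> + 1) / z $ i"] by simp
  qed
  have z1: "z $ i = 0" if "p $ i \<noteq> 0" for i using unb tilt that by blast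
  have z2: "z $ i \<le> 0" for i
  proof (rule ccontr)
    assume pos: "\<not> z $ i \<le> 0"
    then have "- (\<mu> + 1) / z $ i \<le> 0" using \<mu> by (simp add: divide_le_0_iff)
    then show False using tilt[of "- (\<mu> + 1) / z $ i" i] pos by simp
  qed
  \<comment> \<open>Take \<open>b = t\<close> and let \<open>e\<close> decrease to
    \<open>\<phi> t\<close>.\<close>
  have main: "0 \<le> y \<bullet> (?J *v t) + z \<bullet> t + \<mu> * \<phi> t" for t
  proof (rule field_le_epsilon)
    fix e :: real assume "0 < e"
    then have "0 < e / (\<mu> + 1)" using \<mu> by simp
    then have "0 \<le> y \<bullet> (?J *v t) + z \<bullet> t + \<mu> * (\<phi> t + e / (\<mu> + 1))" by (intro sep) auto
    moreover have "\<mu> * (e / (\<mu> + 1)) \<le> e" using \<open>0 < e\<close> \<mu> by (simp add: field_simps)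
    ultimately show "0 \<le> y \<bullet> (?J *v t) + z \<bullet> t + \<mu> * \<phi> t + e" by (simp add: distrib_left)
  qed
  have "\<mu> \<noteq> 0"
  proof
    assume 0: "\<mu> = 0"
    \<comment> \<open>By LICQ some direction pairs with the multipliers to minus their squared
      norms, so \<open>\<mu> = 0\<close> would make the whole separating vector zero.\<close>
    obtain h where h: "?J *v h = - y" "\<And>i. p $ i = 0 \<Longrightarrow> h $ i = (- z) $ i"
      using licq_onto[OF licq, of "- y" "- z"] by blast
    have "z $ i \<bullet> h $ i = - (z $ i \<bullet> z $ i)" for i
      using h(2)[of i] z1[of i] by (cases "p $ i = 0") simp_all
    then have "z \<bullet> h = - (z \<bullet> z)" by (simp add: inner_vec_def sum_negf)
    then have "y \<bullet> y + z \<bullet> z \<le> 0" using main[of h] h(1) 0 by simp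
    then have "y \<bullet> y = 0" "z \<bullet> z = 0" using inner_ge_zero[of y] inner_ge_zero[of z] by linarith+
    then have "y = 0 \<and> z = 0" by simp
    with yz 0 \<open>w \<noteq> 0\<close> show False by (simp add: zero_prod_def)
  qed
  with \<mu> have \<mu>: "0 < \<mu>" by simp
  show thesis
  proof
    show "0 \<le> \<phi> t + (y /\<^sub>R \<mu>) \<bullet> (?J *v t) + (z /\<^sub>R \<mu>) \<bullet> t" for t
    proof -
      have "0 \<le> inverse \<mu> * (y \<bullet> (?J *v t) + z \<bullet> t + \<mu> * \<phi> t)" using main[of t] \<mu> by simp
      also have "\<dots> = \<phi> t + (y /\<^sub>R \<mu>) \<bullet> (?J *v t) + (z /\<^sub>R \<mu>) \<bullet> t"
        using \<mu> by (simp add: distrib_left)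
      finally show ?thesis .
    qed
    show "(z /\<^sub>R \<mu>) $ i \<le> 0" for i using z2[of i] \<mu> by (simp add: mult_nonneg_nonpos)
    show "(z /\<^sub>R \<mu>) $ i = 0" if "p $ i \<noteq> 0" for i using z1[OF that] by simp
  qed
qed

text \<open>The hypothesis gives \<open>norm w / 2 \<le> norm (A *v (B *v w))\<close>, so this
  square system is injective and therefore surjective.\<close>

lemma approx_right_inverse_solve:
  fixes A :: "real ^ 'n ^ 'm" and B :: "real ^ 'm ^ 'n"
  assumes "\<And>w. norm (A *v (B *v w) - w) \<le> norm w / 2"
  obtains w where "A *v (B *v w) = b" "norm w \<le> 2 * norm b"
proof -
  have lo: "norm w / 2 \<le> norm (A *v (B *v w))" for w
    using assms[of w] norm_triangle_ineq2[of w "w - A *v (B *v w)"]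
    by (simp add: norm_minus_commute)
  have lin: "linear (\<lambda>w. A *v (B *v w))"
    by (simp add: matrix_vector_mul_assoc)
  have "inj (\<lambda>w. A *v (B *v w))"
    unfolding linear_injective_0[OF lin] using lo by (metis norm_zero norm_le_zero_iff divide_le_0_iff zero_less_numeral not_less)
  then have "surj (\<lambda>w. A *v (B *v w))" using lin linear_injective_imp_surjective by blast
  then obtain w where "A *v (B *v w) = b" by (metis surjD)
  then show thesis using that[of w] lo[of w] by simp
qed

section \<open>Optimality of the tangential step and its limit\<close>

context problem
begin

text \<open>Compare the step \<open>s\<close> with \<open>s + \<theta> *\<^sub>R t\<close>.
  Convexity bounds the increment of \<open>r\<close> by \<open>\<theta>\<close> times its increment
  over all of \<open>t\<close>, and the proximal term adds only a remainder of order
  \<open>\<theta>\<^sup>2\<close>.\<close>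

lemma iteration_variational:
  assumes it: "iteration x \<alpha> v u" and t: "Jac c x *v t = 0" "x + (v + u) + t \<in> Omega"
  shows "0 \<le> gradient f x \<bullet> t + ((v + u) /\<^sub>R \<alpha>) \<bullet> t + r (x + (v + u) + t) - r (x + (v + u))"
proof (rule ccontr)
  let ?s = "v + u"
  define a where "a = gradient f x \<bullet> t + (?s /\<^sub>R \<alpha>) \<bullet> t + r (x + ?s + t) - r (x + ?s)"
  define b where "b = (norm t)\<^sup>2 / (2 * \<alpha>)"
  assume "\<not> 0 \<le> gradient f x \<bullet> t + (?s /\<^sub>R \<alpha>) \<bullet> t + r (x + ?s + t) - r (x + ?s)"
  then have a: "a < 0" by (simp add: a_def)
  have \<alpha>: "0 < \<alpha>" and ts: "tangential_step f r c x \<alpha> v u" using it by (auto simp: iteration_def)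
  have b: "0 \<le> b" using \<alpha> by (simp add: b_def)
  have *: "0 \<le> \<theta> * (a + \<theta> * b)" if \<theta>: "0 \<le> \<theta>" "\<theta> \<le> 1" for \<theta>
  proof -
    have seg: "x + (?s + \<theta> *\<^sub>R t) = (1 - \<theta>) *\<^sub>R (x + ?s) + \<theta> *\<^sub>R (x + ?s + t)"
      by (simp add: algebra_simps)
    have "x + (?s + \<theta> *\<^sub>R t) \<in> Omega"
      unfolding seg using t(2) iteration_facts(2)[OF it] \<theta> by (auto simp: Omega_def)
    moreover have "Jac c x *v (?s + \<theta> *\<^sub>R t) = Jac c x *v v"
      using t(1) iteration_facts(1)[OF it] by (simp add: matrix_vector_right_distrib matrix_vector_mult_scaleR)
    ultimately have 1: "obj_model f r x \<alpha> ?s \<le> obj_model f r x \<alpha> (?s + \<theta> *\<^sub>R t)"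
      using tangential_step_optimal(3)[OF ts \<alpha>] by blast
    have 2: "r (x + (?s + \<theta> *\<^sub>R t)) \<le> (1 - \<theta>) * r (x + ?s) + \<theta> * r (x + ?s + t)"
      unfolding seg using \<theta> by (intro convex_onD[OF r_convex]) auto
    have 3: "1 / (2 * \<alpha>) * (norm (?s + \<theta> *\<^sub>R t))\<^sup>2 =
        1 / (2 * \<alpha>) * (norm ?s)\<^sup>2 + \<theta> * ((?s /\<^sub>R \<alpha>) \<bullet> t) + \<theta> * (\<theta> * b)"
    proof -
      have "(norm (?s + \<theta> *\<^sub>R t))\<^sup>2 = (norm ?s)\<^sup>2 + 2 * \<theta> * (?s \<bullet> t) + \<theta> * \<theta> * (norm t)\<^sup>2"
        unfolding power2_norm_eq_inner by (simp add: inner_add_left inner_add_right inner_commute algebra_simps)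
      moreover have "(?s /\<^sub>R \<alpha>) \<bullet> t = (?s \<bullet> t) / \<alpha>" by (simp add: divide_inverse mult.commute)
      ultimately show ?thesis unfolding b_def using \<alpha> by (simp only:) (simp add: field_simps)
    qed
    have 4: "gradient f x \<bullet> (?s + \<theta> *\<^sub>R t) = gradient f x \<bullet> ?s + \<theta> * (gradient f x \<bullet> t)"
      by (simp add: inner_add_right)
    have "0 \<le> \<theta> * (gradient f x \<bullet> t) + (\<theta> * ((?s /\<^sub>R \<alpha>) \<bullet> t) + \<theta> * (\<theta> * b)) +
        ((1 - \<theta>) * r (x + ?s) + \<theta> * r (x + ?s + t) - r (x + ?s))"
      using 1 2 unfolding obj_model_def 3 4 by linarith
    also have "\<dots> = \<theta> * (a + \<theta> * b)" unfolding a_def by (simp add: algebra_simps)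
    finally show ?thesis .
  qed
  \<comment> \<open>Small enough that \<open>\<theta> * b \<le> - a / 2\<close>; the 1 added to
    \<open>b\<close> avoids a zero denominator.\<close>
  define \<theta> where "\<theta> = min 1 (- a / (2 * (b + 1)))"
  have \<theta>: "0 < \<theta>" "\<theta> \<le> 1" using a b by (auto simp: \<theta>_def divide_neg_pos)
  have "\<theta> * b \<le> - a / (2 * (b + 1)) * b" using b by (intro mult_right_mono) (auto simp: \<theta>_def)
  also have "\<dots> \<le> - a / 2"
  proof -
    have "- a * b \<le> - a * (b + 1)" using a by (intro mult_left_mono) auto
    then show ?thesis using b by (simp add: field_simps)
  qed
  finally have "a + \<theta> * b < 0" using a by simp
  then have "\<theta> * (a + \<theta> * b) < 0" using \<theta> by (simp add: mult_pos_neg)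
  with *[of \<theta>] \<theta> show False by simp
qed

text \<open>Feasibility follows from the decrease under LICQ. Stationarity follows by passing to the
  limit in \<open>iteration_variational\<close>, with test directions corrected into the kernel of
  the current Jacobian.\<close>

lemma kkt_limit:
  assumes licq: "licq c p" and p: "p \<in> Omega" and it: "\<And>j. iteration (X j) (A j) (V j) (U j)"
    and X: "X \<longlonglongrightarrow> p" and ratio: "(\<lambda>j. norm (V j + U j) / A j) \<longlonglongrightarrow> 0"
  shows "kkt_point f r c p"
proof -
  define S where "S j = V j + U j" for j
  have A: "0 < A j" "A j \<le> alpha_init P" for j using it[of j] by (auto simp: iteration_def)
  have SA: "(\<lambda>j. S j /\<^sub>R A j) \<longlonglongrightarrow> 0"
    by (rule tendsto_norm_zero_cancel) (use ratio A in \<open>simp add: S_def divide_inverse mult.commute less_imp_le\<close>)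
  have S0: "S \<longlonglongrightarrow> 0"
  proof (rule Lim_null_comparison)
    show "\<forall>\<^sub>F j in sequentially. norm (S j) \<le> alpha_init P * norm (S j /\<^sub>R A j)"
    proof (intro always_eventually allI)
      fix j
      have "norm (S j) = A j * norm (S j /\<^sub>R A j)" using A(1)[of j] by simp
      also have "\<dots> \<le> alpha_init P * norm (S j /\<^sub>R A j)" using A by (intro mult_right_mono) auto
      finally show "norm (S j) \<le> alpha_init P * norm (S j /\<^sub>R A j)" .
    qed
    show "(\<lambda>j. alpha_init P * norm (S j /\<^sub>R A j)) \<longlonglongrightarrow> 0"
      by (rule tendsto_mult_right_zero[OF tendsto_norm_zero[OF SA]])
  qed
  have JX: "(\<lambda>j. Jac c (X j)) \<longlonglongrightarrow> Jac c p" and cX: "(\<lambda>j. c (X j)) \<longlonglongrightarrow> c p"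
    and gX: "(\<lambda>j. gradient f (X j)) \<longlonglongrightarrow> gradient f p"
    using isCont_tendsto_compose[OF isCont_Jac X] isCont_tendsto_compose[OF isCont_c X]
      isCont_tendsto_compose[OF isCont_grad X] by auto
  have X_ev: "\<forall>\<^sub>F j in sequentially. Q (X j)" if "\<forall>\<^sub>F x in nhds p. Q x" for Q
    using X that by (simp add: filterlim_iff)

  have cp: "c p = 0"
  proof -
    obtain C where C: "0 < C" and ev: "\<forall>\<^sub>F x in nhds p. \<forall>\<alpha> v. x \<in> Omega \<longrightarrow> 0 < \<alpha> \<longrightarrow> \<alpha> \<le> alpha_init P \<longrightarrow>
      normal_step P c x \<alpha> v \<longrightarrow> \<not> stops_infeasible c x \<longrightarrow> C * \<alpha> * norm (c x) \<le> lin_decrease c x v"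
      using licq_normal_decrease[OF licq p isCont_Jac isCont_c inputs alpha_init_pos] by blast
    \<comment> \<open>The decrease is at least of order \<open>A j * norm (c (X j))\<close> and at
      most of order \<open>norm (S j)\<close>; divide by \<open>A j\<close>.\<close>
    have "\<forall>\<^sub>F j in sequentially. C * norm (c (X j)) \<le> norm (Jac c (X j)) * norm (S j /\<^sub>R A j)"
      using X_ev[OF ev]
    proof eventually_elim
      case (elim j)
      have "C * A j * norm (c (X j)) \<le> lin_decrease c (X j) (V j)"
        using elim it[of j] by (auto simp: iteration_def)
      also have "\<dots> = lin_decrease c (X j) (S j)"
        using iteration_facts(4)[OF it[of j]] by (simp add: S_def)
      also have "\<dots> \<le> norm (Jac c (X j) *v S j)"
        unfolding lin_decrease_def
        using norm_triangle_ineq4[of "c (X j) + Jac c (X j) *v S j" "Jac c (X j) *v S j"] by simp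
      also have "\<dots> \<le> norm (Jac c (X j)) * norm (S j)" by (rule norm_matrix_vector_le)
      also have "\<dots> = A j * (norm (Jac c (X j)) * norm (S j /\<^sub>R A j))" using A(1)[of j] by simp
      finally have "A j * (C * norm (c (X j))) \<le> A j * (norm (Jac c (X j)) * norm (S j /\<^sub>R A j))"
        by (simp add: ac_simps)
      then show ?case using A(1)[of j] by (rule mult_left_le_imp_le)
    qed
    moreover have "(\<lambda>j. C * norm (c (X j))) \<longlonglongrightarrow> C * norm (c p)"
      by (intro tendsto_intros cX)
    moreover have "(\<lambda>j. norm (Jac c (X j)) * norm (S j /\<^sub>R A j)) \<longlonglongrightarrow> norm (Jac c p) * norm (0 :: real ^ 'n)"
      by (intro tendsto_intros JX SA)
    ultimately have "C * norm (c p) \<le> norm (Jac c p) * norm (0 :: real ^ 'n)"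
      using tendsto_le[OF sequentially_bot] by blast
    then show ?thesis using C by (simp add: mult_le_0_iff)
  qed

  obtain B where B: "\<And>w i. p $ i = 0 \<Longrightarrow> (B *v w) $ i = 0"
    and evB: "\<forall>\<^sub>F x in nhds p. \<forall>w. norm (Jac c x *v (B *v w) - w) \<le> norm w / 2"
    using licq_approx_right_inverse[OF licq isCont_Jac] by blast
  \<comment> \<open>Strict positivity at inactive coordinates leaves room for small perturbations of
    the test direction.\<close>
  have local_opt: "0 \<le> gradient f p \<bullet> t + r (p + t) - r p"
    if t: "Jac c p *v t = 0" "\<And>i. p $ i = 0 \<Longrightarrow> 0 \<le> t $ i" "\<And>i. p $ i \<noteq> 0 \<Longrightarrow> 0 < p $ i + t $ i" for t
  proof -
    \<comment> \<open>The correction \<open>B *v w\<close> cancels \<open>Jac c x *v t\<close>. The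
      condition is put inside the existential so that a function \<open>W\<close> can be chosen for
      all \<open>x\<close>.\<close>
    have "\<exists>w. (\<forall>w. norm (Jac c x *v (B *v w) - w) \<le> norm w / 2) \<longrightarrow>
        Jac c x *v (B *v w) = - (Jac c x *v t) \<and> norm w \<le> 2 * norm (- (Jac c x *v t))" for x
      using approx_right_inverse_solve[of "Jac c x" B "- (Jac c x *v t)"] by blast
    then obtain W where W: "\<And>x. (\<forall>w. norm (Jac c x *v (B *v w) - w) \<le> norm w / 2) \<Longrightarrow>
        Jac c x *v (B *v W x) = - (Jac c x *v t) \<and> norm (W x) \<le> 2 * norm (- (Jac c x *v t))"
      by metis
    define E where "E j = B *v W (X j)" for j
    have Jt: "(\<lambda>j. Jac c (X j) *v t) \<longlonglongrightarrow> 0"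
      using tendsto_matrix_vector[OF JX tendsto_const, of t] t(1) by simp
    have "(\<lambda>j. W (X j)) \<longlonglongrightarrow> 0"
    proof (rule Lim_null_comparison)
      show "\<forall>\<^sub>F j in sequentially. norm (W (X j)) \<le> 2 * norm (- (Jac c (X j) *v t))"
        using X_ev[OF evB] by eventually_elim (use W in blast)
      show "(\<lambda>j. 2 * norm (- (Jac c (X j) *v t))) \<longlonglongrightarrow> 0"
        using tendsto_mult_right_zero[OF tendsto_norm_zero[OF Jt], of 2] by simp
    qed
    then have E0: "E \<longlonglongrightarrow> 0"
      unfolding E_def using tendsto_matrix_vector[OF tendsto_const[of B]] by fastforce
    have lim: "(\<lambda>j. X j + S j + (t + E j)) \<longlonglongrightarrow> p + 0 + (t + 0)"
      by (intro tendsto_intros X S0 E0)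
    \<comment> \<open>At active coordinates the correction vanishes and \<open>t\<close> is
      nonnegative; at inactive ones the limit is strictly positive.\<close>
    have feas: "\<forall>\<^sub>F j in sequentially. 0 \<le> (X j + S j + (t + E j)) $ i" for i
    proof (cases "p $ i = 0")
      case True
      have "0 \<le> (X j + S j) $ i" for j
        using iteration_facts(2)[OF it[of j]] by (simp add: Omega_def S_def)
      then show ?thesis using t(2)[OF True] B[OF True] by (simp add: E_def)
    next
      case False
      have "\<forall>\<^sub>F j in sequentially. 0 < (X j + S j + (t + E j)) $ i"
        using order_tendstoD(1)[OF tendsto_vec_nth[OF lim], of 0 i] t(3)[OF False] by simp
      then show ?thesis by eventually_elim simp
    qed
    have "\<forall>\<^sub>F j in sequentially. \<forall>i. 0 \<le> (X j + S j + (t + E j)) $ i"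
      using feas by (simp add: eventually_all_finite)
    then have "\<forall>\<^sub>F j in sequentially. 0 \<le> gradient f (X j) \<bullet> (t + E j) + (S j /\<^sub>R A j) \<bullet> (t + E j) +
        r (X j + S j + (t + E j)) - r (X j + S j)"
      using X_ev[OF evB]
    proof eventually_elim
      case (elim j)
      show ?case unfolding S_def
      proof (rule iteration_variational[OF it])
        show "Jac c (X j) *v (t + E j) = 0"
          using W elim(2) by (simp add: E_def matrix_vector_right_distrib)
        show "X j + (V j + U j) + (t + E j) \<in> Omega" using elim(1) by (simp add: Omega_def S_def)
      qed
    qed
    moreover have "(\<lambda>j. gradient f (X j) \<bullet> (t + E j) + (S j /\<^sub>R A j) \<bullet> (t + E j) +
        r (X j + S j + (t + E j)) - r (X j + S j)) \<longlonglongrightarrow>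
        gradient f p \<bullet> (t + 0) + 0 \<bullet> (t + 0) + r (p + 0 + (t + 0)) - r (p + 0)"
      by (intro tendsto_intros gX SA E0 isCont_tendsto_compose[OF isCont_r] X S0)
    ultimately show ?thesis
      using tendsto_lowerbound[of _ _ sequentially 0] by fastforce
  qed

  define \<phi> where "\<phi> t = gradient f p \<bullet> t + r (p + t) - r p" for t
  have cv: "convex_on UNIV \<phi>"
  proof (rule convex_onI)
    fix \<theta> :: real and t1 t2 assume \<theta>: "0 < \<theta>" "\<theta> < 1"
    have seg: "p + ((1 - \<theta>) *\<^sub>R t1 + \<theta> *\<^sub>R t2) = (1 - \<theta>) *\<^sub>R (p + t1) + \<theta> *\<^sub>R (p + t2)"
      by (simp add: algebra_simps)
    have "r (p + ((1 - \<theta>) *\<^sub>R t1 + \<theta> *\<^sub>R t2)) \<le> (1 - \<theta>) * r (p + t1) + \<theta> * r (p + t2)"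
      unfolding seg using \<theta> by (intro convex_onD[OF r_convex]) auto
    then show "\<phi> ((1 - \<theta>) *\<^sub>R t1 + \<theta> *\<^sub>R t2) \<le> (1 - \<theta>) * \<phi> t1 + \<theta> * \<phi> t2"
      unfolding \<phi>_def by (simp add: inner_add_right algebra_simps)
  qed simp
  have \<phi>0: "\<phi> 0 = 0" by (simp add: \<phi>_def)
  have opt: "0 \<le> \<phi> t" if t: "Jac c p *v t = 0" "\<And>i. p $ i = 0 \<Longrightarrow> 0 \<le> t $ i" for t
  proof -
    obtain \<rho> where \<rho>: "0 < \<rho>" "\<forall>\<^sub>F x in nhds p. \<forall>i. p $ i \<noteq> 0 \<longrightarrow> \<rho> \<le> x $ i"
      using eventually_inactive[OF p] by blast
    obtain d where d: "0 < d" "\<And>x i. dist x p < d \<Longrightarrow> p $ i \<noteq> 0 \<Longrightarrow> \<rho> \<le> x $ i"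
      using \<rho>(2) unfolding eventually_nhds_metric by blast
    have nt: "0 < norm t + 1" by (simp add: add_nonneg_pos)
    \<comment> \<open>A scaled direction meets the strict positivity of \<open>local_opt\<close>;
      convexity and \<open>\<phi> 0 = 0\<close> carry the inequality back to
      \<open>t\<close>.\<close>
    define \<theta> where "\<theta> = min 1 (d / (norm t + 1))"
    have \<theta>: "0 < \<theta>" "\<theta> \<le> 1" using d nt by (auto simp: \<theta>_def)
    have "\<theta> * norm t < \<theta> * (norm t + 1)" using \<theta> by simp
    also have "\<dots> \<le> d / (norm t + 1) * (norm t + 1)" using nt by (intro mult_right_mono) (auto simp: \<theta>_def)
    finally have near: "dist (p + \<theta> *\<^sub>R t) p < d" using nt \<theta> by (simp add: dist_norm)
    have "0 \<le> \<phi> (\<theta> *\<^sub>R t)" unfolding \<phi>_def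
    proof (rule local_opt)
      show "0 < p $ i + (\<theta> *\<^sub>R t) $ i" if "p $ i \<noteq> 0" for i
        using d(2)[OF near that] \<rho>(1) by simp
    qed (use t \<theta> in \<open>auto simp: matrix_vector_mult_scaleR\<close>)
    also have "\<phi> (\<theta> *\<^sub>R t) \<le> \<theta> * \<phi> t"
      using convex_onD[OF cv, of \<theta> 0 t] \<theta> \<phi>0 by simp
    finally show ?thesis using \<theta> by (simp add: zero_le_mult_iff)
  qed
  obtain y z where yz: "\<And>t. 0 \<le> \<phi> t + y \<bullet> (Jac c p *v t) + z \<bullet> t"
    "\<And>i. z $ i \<le> 0" "\<And>i. p $ i \<noteq> 0 \<Longrightarrow> z $ i = 0"
    using licq_multipliers[OF licq cv \<phi>0 opt] by blast
  \<comment> \<open>Solved from the stationarity equation; the multiplier inequality is then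
    precisely the subgradient inequality at \<open>p\<close>.\<close>
  let ?g = "- (gradient f p + transpose (Jac c p) *v y + z)"
  have "?g \<in> subdifferential r p"
    unfolding subdifferential_def
  proof (intro CollectI allI)
    fix q
    have "y \<bullet> (Jac c p *v (q - p)) = (transpose (Jac c p) *v y) \<bullet> (q - p)"
      by (metis inner_commute inner_transpose)
    then show "r p + ?g \<bullet> (q - p) \<le> r q"
      using yz(1)[of "q - p"] unfolding \<phi>_def inner_minus_left inner_add_left by simp
  qed
  moreover have "gradient f p + ?g + transpose (Jac c p) *v y + z = 0" by simp
  moreover have "min (p $ i) (- (z $ i)) = 0" for i
    using yz(2,3)[of i] p by (cases "p $ i = 0") (auto simp: Omega_def)
  ultimately show ?thesis unfolding kkt_point_def using cp by blast
qed

text \<open>Otherwise there are iterations arbitrarily close to \<open>p\<close> with arbitrarily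
  small ratio of step to step size, and \<open>kkt_limit\<close> applies to them.\<close>

lemma not_kkt_step_lower_bound:
  assumes "licq c p" "p \<in> Omega" "\<not> kkt_point f r c p"
  obtains \<epsilon> where "0 < \<epsilon>" "\<forall>\<^sub>F x in nhds p. \<forall>\<alpha> v u. iteration x \<alpha> v u \<longrightarrow> \<epsilon> * \<alpha> \<le> norm (v + u)"
proof (rule ccontr)
  assume no: "\<not> thesis"
  define e where "e j = inverse (real (Suc j))" for j
  have e: "0 < e j" for j by (simp add: e_def)
  have "\<exists>x \<alpha> v u. dist x p < e j \<and> iteration x \<alpha> v u \<and> norm (v + u) < e j * \<alpha>" for j
  proof -
    have "\<not> (\<forall>\<^sub>F x in nhds p. \<forall>\<alpha> v u. iteration x \<alpha> v u \<longrightarrow> e j * \<alpha> \<le> norm (v + u))"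
      using no that e by blast
    then show ?thesis unfolding eventually_nhds_metric using e by (meson not_le)
  qed
  then obtain X A V U where seq: "\<And>j. dist (X j) p < e j" "\<And>j. iteration (X j) (A j) (V j) (U j)"
    "\<And>j. norm (V j + U j) < e j * A j" by metis
  have e0: "e \<longlonglongrightarrow> 0" unfolding e_def by (rule LIMSEQ_inverse_real_of_nat)
  have "X \<longlonglongrightarrow> p"
    by (rule metric_tendsto_imp_tendsto[OF e0])
      (use seq(1) e in \<open>auto intro!: always_eventually simp: less_imp_le dist_real_def\<close>)
  moreover have "(\<lambda>j. norm (V j + U j) / A j) \<longlonglongrightarrow> 0"
  proof (rule Lim_null_comparison[OF _ e0], intro always_eventually allI)
    fix j
    have "0 < A j" using seq(2)[of j] by (simp add: iteration_def)
    then show "norm (norm (V j + U j) / A j) \<le> e j" using seq(3)[of j] by (simp add: field_simps)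
  qed
  ultimately have "kkt_point f r c p" 
    using kkt_limit[where X = X and A = A and V = V and U = U, OF assms(1,2) seq(2)] by blast
  with assms(3) show False by simp
qed

end

section \<open>Convergence of a run\<close>

lemma infinite_limit_point:
  fixes x :: "nat \<Rightarrow> 'a::heine_borel"
  assumes "bounded (range x)" "infinite K"
  obtains \<phi> p where "strict_mono \<phi>" "\<And>j. \<phi> j \<in> K" "(x \<circ> \<phi>) \<longlonglongrightarrow> p"
proof -
  obtain e :: "nat \<Rightarrow> nat" where e: "strict_mono e" "\<And>j. e j \<in> K"
    using infinite_enumerate[OF assms(2)] by blast
  have "bounded (range (x \<circ> e))" using assms(1) by (rule bounded_subset) auto
  then obtain p \<rho> where \<rho>: "strict_mono \<rho>" "((x \<circ> e) \<circ> \<rho>) \<longlonglongrightarrow> p"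
    using bounded_imp_convergent_subsequence by blast
  show thesis
    by (rule that[of "e \<circ> \<rho>" p]) (use e \<rho> in \<open>auto simp: strict_mono_o comp_assoc\<close>)
qed

text \<open>The bound on \<open>t'\<close> is a product, so it also covers an infinite trial value.
  Hypothesis \<open>pos\<close> makes every finite trial value positive.\<close>

lemma tau_update_facts:
  assumes up: "tau_update P t (tau_trial P f r c x \<alpha> s) t'" and t: "0 < t" and P: "valid_inputs P"
    and \<Delta>: "0 \<le> lin_decrease c x s"
    and pos: "0 < obj_model f r x \<alpha> s \<Longrightarrow> 0 < lin_decrease c x s"
  shows "0 < t'" "t' * obj_model f r x \<alpha> s \<le> (1 - sigma_c P) * lin_decrease c x s"
    and "t' = t \<or> t' \<le> (1 - eps_tau P) * t \<and> 0 < obj_model f r x \<alpha> s \<and>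
      (1 - sigma_c P) * lin_decrease c x s < t * obj_model f r x \<alpha> s"
proof -
  define A where "A = obj_model f r x \<alpha> s"
  define D where "D = (1 - sigma_c P) * lin_decrease c x s"
  have \<sigma>: "0 < 1 - sigma_c P" "0 < 1 - eps_tau P" using P by (auto simp: valid_inputs_def)
  have D: "0 \<le> D" "0 < A \<Longrightarrow> 0 < D" using \<sigma> \<Delta> pos by (auto simp: D_def A_def)
  have trial: "tau_trial P f r c x \<alpha> s = (if A \<le> 0 then \<infinity> else ereal (D / A))"
    unfolding tau_trial_def A_def obj_model_def D_def Let_def by simp
  have "0 < t' \<and> t' * A \<le> D \<and> (t' = t \<or> t' \<le> (1 - eps_tau P) * t \<and> 0 < A \<and> D < t * A)"
  proof (cases "A \<le> 0")
    case True
    then have t': "t' = t" using up unfolding tau_update_def trial by simp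
    have "t * A \<le> 0" using True t by (simp add: mult_le_0_iff)
    then show ?thesis using t' t D by simp
  next
    case A: False
    then have t': "t' = (if t \<le> D / A then t else min ((1 - eps_tau P) * t) (D / A))"
      using up unfolding tau_update_def trial by (auto split: if_splits simp: min_def)
    show ?thesis
    proof (cases "t \<le> D / A")
      case True
      then show ?thesis using t' t A by (simp add: field_simps)
    next
      case False
      then have "t' \<le> D / A" "t' \<le> (1 - eps_tau P) * t" "0 < t'"
        using t' A D \<sigma> t by auto
      then show ?thesis using False A by (simp add: field_simps)
    qed
  qed
  then show "0 < t'" "t' * obj_model f r x \<alpha> s \<le> (1 - sigma_c P) * lin_decrease c x s"
    "t' = t \<or> t' \<le> (1 - eps_tau P) * t \<and> 0 < obj_model f r x \<alpha> s \<and>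
      (1 - sigma_c P) * lin_decrease c x s < t * obj_model f r x \<alpha> s"
    by (auto simp: A_def D_def)
qed

section \<open>Invariants of a nonterminating run\<close>

locale run = problem f r c P
  for f r :: "real ^ 'n \<Rightarrow> real" and c :: "real ^ 'n \<Rightarrow> real ^ 'm" and P :: "'n inputs" +
  fixes x v u :: "nat \<Rightarrow> real ^ 'n" and \<alpha> \<tau> :: "nat \<Rightarrow> real"
  assumes alg: "algorithm_run P f r c x v u \<alpha> \<tau>"
    and no_stop: "\<And>k. \<not> terminates_at c x v u k"
    and x_bounded: "bounded (range x)"
    and licq: "\<And>p. limit_point_along UNIV x p \<Longrightarrow> licq c p"
begin

abbreviation s :: "nat \<Rightarrow> real ^ 'n" where "s k \<equiv> v k + u k"

definition tau_prev :: "nat \<Rightarrow> real" where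
  "tau_prev k = (if k = 0 then tau_init P else \<tau> (k - 1))"

lemma s_nonzero: "s k \<noteq> 0"
  using no_stop[of k] by (simp add: terminates_at_def)

lemma alg_step:
  shows "normal_step P c (x k) (\<alpha> k) (v k)" "\<not> stops_infeasible c (x k)"
    "tangential_step f r c (x k) (\<alpha> k) (v k) (u k)"
    "tau_update P (tau_prev k) (tau_trial P f r c (x k) (\<alpha> k) (s k)) (\<tau> k)"
    "sufficient_decrease P f r c (x k) (\<alpha> k) (\<tau> k) (s k) \<Longrightarrow> x (Suc k) = x k + s k \<and> \<alpha> (Suc k) = \<alpha> k"
    "\<not> sufficient_decrease P f r c (x k) (\<alpha> k) (\<tau> k) (s k) \<Longrightarrow> x (Suc k) = x k \<and> \<alpha> (Suc k) = xi P * \<alpha> k"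
proof -
  show ns: "\<not> stops_infeasible c (x k)" using no_stop[of k] by (simp add: terminates_at_def)
  have "\<forall>j<k. \<not> terminates_at c x v u j" using no_stop by blast
  note step = alg[unfolded algorithm_run_def Let_def, THEN conjunct2, THEN conjunct2, rule_format, OF this[rule_format]]
  show "normal_step P c (x k) (\<alpha> k) (v k)" using step by blast
  show "tangential_step f r c (x k) (\<alpha> k) (v k) (u k)" using step ns by blast
  show "tau_update P (tau_prev k) (tau_trial P f r c (x k) (\<alpha> k) (s k)) (\<tau> k)"
    using step ns s_nonzero[of k] unfolding tau_prev_def by blast
  show "x (Suc k) = x k + s k \<and> \<alpha> (Suc k) = \<alpha> k"
    if "sufficient_decrease P f r c (x k) (\<alpha> k) (\<tau> k) (s k)"
    using step ns s_nonzero[of k] that by simp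
  show "x (Suc k) = x k \<and> \<alpha> (Suc k) = xi P * \<alpha> k"
    if "\<not> sufficient_decrease P f r c (x k) (\<alpha> k) (\<tau> k) (s k)"
    using step ns s_nonzero[of k] that by simp
qed

lemma invariant: "x k \<in> Omega \<and> 0 < \<alpha> k \<and> \<alpha> k \<le> alpha_init P"
proof (induction k)
  case 0
  then show ?case using alg inputs by (auto simp: algorithm_run_def valid_inputs_def)
next
  case (Suc k)
  have \<xi>: "0 < xi P" "xi P < 1" using inputs by (auto simp: valid_inputs_def)
  have "x k + s k \<in> Omega" using tangential_step_optimal(2)[OF alg_step(3)] Suc by blast
  moreover have "xi P * \<alpha> k \<le> \<alpha> k" using \<xi> Suc by auto
  then have "xi P * \<alpha> k \<le> alpha_init P" using Suc by linarith
  moreover have "0 < xi P * \<alpha> k" using \<xi> Suc by auto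
  ultimately show ?case using alg_step(5,6)[of k] Suc
    by (cases "sufficient_decrease P f r c (x k) (\<alpha> k) (\<tau> k) (s k)") simp_all
qed

lemma run_iteration: "iteration (x k) (\<alpha> k) (v k) (u k)"
proof -
  have "x k + v k \<in> Omega"
    using alg_step(1)[of k] invariant[of k] by (cases "delta c (x k) = 0") (auto simp: normal_step_def)
  then show ?thesis using alg_step(1-3)[of k] invariant[of k] by (simp add: iteration_def)
qed

lemma alpha_decseq: "decseq \<alpha>"
proof (rule decseq_SucI)
  fix k
  have "xi P * \<alpha> k \<le> \<alpha> k" using inputs invariant[of k] by (auto simp: valid_inputs_def)
  then show "\<alpha> (Suc k) \<le> \<alpha> k" using alg_step(5,6)[of k] by force
qed

text \<open>A rejected step leaves \<open>x\<close> unchanged; since the step is nonzero, this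
  cannot coincide with acceptance.\<close>

lemma successful_iff:
  "k \<in> successful x v u \<longleftrightarrow> sufficient_decrease P f r c (x k) (\<alpha> k) (\<tau> k) (s k)"
proof
  assume k: "k \<in> successful x v u"
  show "sufficient_decrease P f r c (x k) (\<alpha> k) (\<tau> k) (s k)"
  proof (rule ccontr)
    assume "\<not> sufficient_decrease P f r c (x k) (\<alpha> k) (\<tau> k) (s k)"
    then have "x k = x k + s k" using alg_step(6) k by (simp add: successful_def)
    then show False using s_nonzero[of k] by (simp only: add_cancel_right_right)
  qed
qed (use alg_step(5) in \<open>simp add: successful_def\<close>)

text \<open>For \<open>v k = 0\<close> the model value at the step would be at most its value 0 at
  the zero step.\<close>

lemma obj_model_pos_imp:
  assumes "0 < obj_model f r (x k) (\<alpha> k) (s k)"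
  shows "0 < lin_decrease c (x k) (s k)"
proof -
  have "v k \<noteq> 0"
    using assms iteration_facts(3)[OF run_iteration[of k]] by (auto simp: obj_model_def)
  then show ?thesis
    using normal_step_decrease_pos(2)[OF _ inputs _ alg_step(1)] invariant
      iteration_facts(4)[OF run_iteration] by metis
qed

lemma tau_facts:
  assumes "0 < tau_prev k"
  shows "0 < \<tau> k" "\<tau> k * obj_model f r (x k) (\<alpha> k) (s k) \<le> (1 - sigma_c P) * lin_decrease c (x k) (s k)"
    "\<tau> k = tau_prev k \<or> \<tau> k \<le> (1 - eps_tau P) * tau_prev k \<and> 0 < obj_model f r (x k) (\<alpha> k) (s k) \<and>
      (1 - sigma_c P) * lin_decrease c (x k) (s k) < tau_prev k * obj_model f r (x k) (\<alpha> k) (s k)"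
  using tau_update_facts[OF alg_step(4) assms inputs iteration_facts(5)[OF run_iteration] obj_model_pos_imp]
  by blast+

lemma tau_prev_pos: "0 < tau_prev k"
proof (induction k)
  case 0
  then show ?case using inputs by (simp add: tau_prev_def valid_inputs_def)
next
  case (Suc k)
  then show ?case using tau_facts(1)[of k] by (simp add: tau_prev_def)
qed

lemmas tau_pos = tau_facts(1)[OF tau_prev_pos]

lemma tau_Suc: "\<tau> (Suc k) = \<tau> k \<or> \<tau> (Suc k) \<le> (1 - eps_tau P) * \<tau> k \<and>
    0 < obj_model f r (x (Suc k)) (\<alpha> (Suc k)) (s (Suc k)) \<and>
    (1 - sigma_c P) * lin_decrease c (x (Suc k)) (s (Suc k)) <
      \<tau> k * obj_model f r (x (Suc k)) (\<alpha> (Suc k)) (s (Suc k))"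
  using tau_facts(3)[OF tau_prev_pos, of "Suc k"] by (simp add: tau_prev_def)

lemma tau_decseq: "decseq \<tau>"
proof (rule decseq_SucI)
  fix k
  have "(1 - eps_tau P) * \<tau> k \<le> 1 * \<tau> k"
    using inputs tau_pos[of k] by (intro mult_right_mono) (auto simp: valid_inputs_def)
  then show "\<tau> (Suc k) \<le> \<tau> k" using tau_Suc[of k] by linarith
qed

lemma limit_in_Omega:
  assumes "(x \<circ> \<phi>) \<longlonglongrightarrow> p"
  shows "p \<in> Omega"
  by (rule closed_sequentially[OF closed_Omega _ assms]) (simp add: invariant)

text \<open>Each change lowers \<open>\<tau>\<close> by at least a fixed factor, so infinitely many
  changes exclude a positive limit. But near a limit point of the iterates causing changes, the
  value before a change stays above a positive constant.\<close>

lemma tau_eventually_const: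
  obtains T K where "0 < T" "\<And>k. K \<le> k \<Longrightarrow> \<tau> k = T"
proof -
  let ?C = "{k. \<tau> (Suc k) \<noteq> \<tau> k}"
  have \<sigma>: "0 < 1 - sigma_c P" "0 < eps_tau P" using inputs by (auto simp: valid_inputs_def)
  have "finite ?C"
  proof (rule ccontr)
    assume "infinite ?C"
    \<comment> \<open>The change from \<open>k\<close> to \<open>Suc k\<close> is caused by the
      iterate with index \<open>Suc k\<close>, so limit points are taken along the shifted
      indices.\<close>
    then have "infinite (Suc ` ?C)" by (simp add: finite_image_iff)
    then obtain \<phi> p where \<phi>: "strict_mono \<phi>" "\<And>j. \<phi> j \<in> Suc ` ?C" "(x \<circ> \<phi>) \<longlonglongrightarrow> p"
      using infinite_limit_point[OF x_bounded] by blast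
    then have lp: "licq c p" using licq by (auto simp: limit_point_along_def)
    obtain C where C: "0 < C" and ev: "\<forall>\<^sub>F x in nhds p. \<forall>\<alpha> v u. iteration x \<alpha> v u \<longrightarrow>
       C * obj_model f r x \<alpha> (v + u) \<le> lin_decrease c x (v + u)"
      using iteration_obj_model_le[OF lp limit_in_Omega[OF \<phi>(3)]] by blast
    obtain L where L: "\<tau> \<longlonglongrightarrow> L" "\<And>k. L \<le> \<tau> k"
      using decseq_convergent[OF tau_decseq, of 0] tau_pos less_imp_le by blast
    define \<psi> where "\<psi> j = \<phi> j - 1" for j
    have \<psi>: "\<phi> j = Suc (\<psi> j)" "\<tau> (Suc (\<psi> j)) \<noteq> \<tau> (\<psi> j)" for j
      using \<phi>(2)[of j] by (auto simp: \<psi>_def)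
    have \<psi>_mono: "strict_mono \<psi>"
      using \<phi>(1) unfolding strict_mono_def by (simp add: \<psi>(1))
    have \<tau>\<psi>: "(\<lambda>j. \<tau> (\<psi> j)) \<longlonglongrightarrow> L"
      using LIMSEQ_subseq_LIMSEQ[OF L(1) \<psi>_mono] by (simp add: comp_def)
    have "\<forall>\<^sub>F j in sequentially. \<forall>\<alpha> v u. iteration (x (\<phi> j)) \<alpha> v u \<longrightarrow>
       C * obj_model f r (x (\<phi> j)) \<alpha> (v + u) \<le> lin_decrease c (x (\<phi> j)) (v + u)"
      using eventually_compose_filterlim[OF ev \<phi>(3)] by (simp only: comp_apply)
    then have "\<forall>\<^sub>F j in sequentially. (1 - sigma_c P) * C \<le> \<tau> (\<psi> j)"
    proof eventually_elim
      case (elim j)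
      let ?k = "Suc (\<psi> j)"
      let ?A = "obj_model f r (x ?k) (\<alpha> ?k) (s ?k)"
      have A: "0 < ?A" "(1 - sigma_c P) * lin_decrease c (x ?k) (s ?k) < \<tau> (\<psi> j) * ?A"
        using tau_Suc[of "\<psi> j"] \<psi>(2)[of j] by auto
      have "(1 - sigma_c P) * (C * ?A) \<le> (1 - sigma_c P) * lin_decrease c (x ?k) (s ?k)"
        using elim run_iteration[of ?k] \<sigma> by (intro mult_left_mono) (auto simp: \<psi>(1))
      then have "((1 - sigma_c P) * C) * ?A < \<tau> (\<psi> j) * ?A" using A(2) by simp
      then show ?case using A(1) by simp
    qed
    then have "(1 - sigma_c P) * C \<le> L"
      by (rule tendsto_lowerbound[OF \<tau>\<psi>]) simp
    moreover have "0 < (1 - sigma_c P) * C" using \<sigma> C by simp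
    ultimately have "0 < L" by linarith
    have "L \<le> (1 - eps_tau P) * L"
    proof (rule tendsto_lowerbound[OF tendsto_mult_left[OF \<tau>\<psi>]])
      have "L \<le> (1 - eps_tau P) * \<tau> (\<psi> j)" for j
        using tau_Suc[of "\<psi> j"] \<psi>(2)[of j] L(2)[of "Suc (\<psi> j)"] by linarith
      then show "\<forall>\<^sub>F j in sequentially. L \<le> (1 - eps_tau P) * \<tau> (\<psi> j)" by simp
    qed simp
    then have "eps_tau P * L \<le> 0" by (simp add: algebra_simps)
    with \<sigma>(2) \<open>0 < L\<close> show False by (simp add: mult_le_0_iff)
  qed
  then obtain K where K: "\<forall>k\<in>?C. k < K" unfolding finite_nat_set_iff_bounded ..
  have const: "\<tau> k = \<tau> K" if "K \<le> k" for k
    using that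
  proof (induction k rule: dec_induct)
    case (step n)
    then have "n \<notin> ?C" using K by (meson not_le)
    then show ?case using step by simp
  qed simp
  show thesis using that[of "\<tau> K" K] tau_pos const by blast
qed

text \<open>Near a non-KKT limit point merit decrease controls path length. This first rules out
  step sizes bounded below; small step sizes then trap the iterates, so the step sizes stay
  constant, a contradiction.\<close>

lemma limit_point_kkt:
  assumes f_bounded: "\<And>k. F \<le> f (x k)" and lim: "limit_point_along (successful x v u) x x_star"
  shows "kkt_point f r c x_star"
proof (rule ccontr)
  assume not_kkt: "\<not> kkt_point f r c x_star"
  obtain \<phi> where \<phi>: "strict_mono \<phi>" "\<And>j. \<phi> j \<in> successful x v u" "(x \<circ> \<phi>) \<longlonglongrightarrow> x_star"
    using lim unfolding limit_point_along_def by blast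
  then have "licq c x_star" using licq by (auto simp: limit_point_along_def)
  then obtain \<epsilon> where \<epsilon>: "0 < \<epsilon>" and ev1: "\<forall>\<^sub>F y in nhds x_star. \<forall>\<alpha> v u. iteration y \<alpha> v u \<longrightarrow> \<epsilon> * \<alpha> \<le> norm (v + u)"
    using not_kkt_step_lower_bound[OF _ limit_in_Omega[OF \<phi>(3)] not_kkt] by blast
  obtain T K where T: "0 < T" and K: "\<And>k. K \<le> k \<Longrightarrow> \<tau> k = T"
    using tau_eventually_const by blast
  obtain a where a: "0 < a" and ev2: "\<forall>\<^sub>F y in nhds x_star. \<forall>\<alpha> v u. iteration y \<alpha> v u \<longrightarrow> \<alpha> \<le> a \<longrightarrow>
       T * obj_model f r y \<alpha> (v + u) \<le> (1 - sigma_c P) * lin_decrease c y (v + u) \<longrightarrow>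
       \<epsilon> * \<alpha> \<le> norm (v + u) \<longrightarrow> sufficient_decrease P f r c y \<alpha> T (v + u)"
    using iteration_sufficient_decrease[OF T \<epsilon>] by blast
  obtain \<rho> where \<rho>: "0 < \<rho>"
    and near1: "\<And>k. dist (x k) x_star < \<rho> \<Longrightarrow> \<epsilon> * \<alpha> k \<le> norm (s k)"
    and near2: "\<And>k. dist (x k) x_star < \<rho> \<Longrightarrow> \<alpha> k \<le> a \<Longrightarrow>
       T * obj_model f r (x k) (\<alpha> k) (s k) \<le> (1 - sigma_c P) * lin_decrease c (x k) (s k) \<Longrightarrow>
       sufficient_decrease P f r c (x k) (\<alpha> k) T (s k)"
  proof -
    obtain \<rho> where \<rho>: "0 < \<rho>" "\<And>y. dist y x_star < \<rho> \<Longrightarrow> (\<forall>\<alpha> v u. iteration y \<alpha> v u \<longrightarrow> \<epsilon> * \<alpha> \<le> norm (v + u)) \<and>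
       (\<forall>\<alpha> v u. iteration y \<alpha> v u \<longrightarrow> \<alpha> \<le> a \<longrightarrow>
       T * obj_model f r y \<alpha> (v + u) \<le> (1 - sigma_c P) * lin_decrease c y (v + u) \<longrightarrow>
       \<epsilon> * \<alpha> \<le> norm (v + u) \<longrightarrow> sufficient_decrease P f r c y \<alpha> T (v + u))"
      using eventually_conj[OF ev1 ev2] unfolding eventually_nhds_metric by blast
    show thesis
      by (rule that[OF \<rho>(1)]) (use \<rho>(2) run_iteration in \<open>simp_all\<close>)
  qed
  define M where "M k = merit f r c T (x k)" for k
  have \<eta>: "0 < eta_Phi P" "0 < sigma_c P" using inputs by (auto simp: valid_inputs_def)
  \<comment> \<open>The guaranteed decrease
    \<open>eta_Phi P * (T / (4 * \<alpha>)) * (norm s)\<^sup>2\<close>, with one factor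
    \<open>norm s\<close> replaced by its lower bound \<open>\<epsilon> * \<alpha>\<close>.\<close>
  define C where "C = eta_Phi P * (T / 4) * \<epsilon>"
  have C: "0 < C" using \<eta> T \<epsilon> by (simp add: C_def)
  have dec: "eta_Phi P * (T / (4 * \<alpha> k) * (norm (s k))\<^sup>2) \<le> M k - M (Suc k)"
    if "K \<le> k" "k \<in> successful x v u" for k
  proof -
    have "sufficient_decrease P f r c (x k) (\<alpha> k) T (s k)" "x (Suc k) = x k + s k"
      using that successful_iff K by (auto simp: successful_def)
    moreover have "0 \<le> eta_Phi P * (sigma_c P * lin_decrease c (x k) (s k))"
      using \<eta> iteration_facts(5)[OF run_iteration] by (intro mult_nonneg_nonneg) auto
    ultimately show ?thesis unfolding M_def sufficient_decrease_def by (simp add: distrib_left)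
  qed
  have dec_near: "C * norm (s k) \<le> M k - M (Suc k)"
    if "K \<le> k" "k \<in> successful x v u" "dist (x k) x_star < \<rho>" for k
  proof -
    have \<alpha>: "0 < \<alpha> k" using invariant by blast
    have "C * norm (s k) = eta_Phi P * (T / (4 * \<alpha> k) * ((\<epsilon> * \<alpha> k) * norm (s k)))"
      using \<alpha> by (simp add: C_def)
    also have "\<dots> \<le> eta_Phi P * (T / (4 * \<alpha> k) * (norm (s k) * norm (s k)))"
      using near1[OF that(3)] \<eta> T \<alpha> by (intro mult_left_mono mult_right_mono) auto
    also have "\<dots> \<le> M k - M (Suc k)" using dec[OF that(1,2)] by (simp add: power2_eq_square)
    finally show ?thesis .
  qed
  have M_Suc: "M (Suc k) \<le> M k" if "K \<le> k" for k
  proof (cases "k \<in> successful x v u")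
    case True
    have "0 \<le> eta_Phi P * (T / (4 * \<alpha> k) * (norm (s k))\<^sup>2)"
      using \<eta> T invariant[of k] by (intro mult_nonneg_nonneg divide_nonneg_nonneg) auto
    then show ?thesis using dec[OF that True] by linarith
  next
    case False
    then have "x (Suc k) = x k" using successful_iff alg_step(6) by blast
    then show ?thesis by (simp add: M_def)
  qed
  have "T * F \<le> M k" for k
  proof -
    have "T * F \<le> T * (f (x k) + r (x k))"
      using T f_bounded[of k] r_nonneg[of "x k"] by (intro mult_left_mono) auto
    then show ?thesis by (simp add: M_def merit_def add_increasing2)
  qed
  moreover have "decseq (\<lambda>k. M (k + K))" using M_Suc by (intro decseq_SucI) simp
  ultimately obtain L where L: "(\<lambda>k. M (k + K)) \<longlonglongrightarrow> L" "\<forall>k. L \<le> M (k + K)"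
    using decseq_convergent[of "\<lambda>k. M (k + K)" "T * F"] by blast
  have M_lim: "M \<longlonglongrightarrow> L" using L(1) by (rule LIMSEQ_offset)
  have M_ge: "L \<le> M k" if "K \<le> k" for k using L(2)[rule_format, of "k - K"] that by simp
  have M\<phi>: "(\<lambda>j. M (\<phi> j)) \<longlonglongrightarrow> L" and M\<phi>': "(\<lambda>j. M (Suc (\<phi> j))) \<longlonglongrightarrow> L"
    using LIMSEQ_subseq_LIMSEQ[OF M_lim \<phi>(1)] LIMSEQ_subseq_LIMSEQ[OF LIMSEQ_Suc[OF M_lim] \<phi>(1)]
    by (simp_all add: comp_def)
  have \<phi>_large: "\<forall>\<^sub>F j in sequentially. k \<le> \<phi> j" for k
    using filterlim_subseq[OF \<phi>(1)] by (simp add: filterlim_at_top)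
  have \<phi>_near: "\<forall>\<^sub>F j in sequentially. dist (x (\<phi> j)) x_star < d" if "0 < d" for d
    using tendstoD[OF \<phi>(3) that] by simp
  \<comment> \<open>Infinitely many successful steps near \<open>x_star\<close> would each lower the
    convergent merit values by at least \<open>C * \<epsilon> * b\<close>.\<close>
  have \<alpha>_not_bounded_below: False if b: "0 < b" "\<And>k. b \<le> \<alpha> k" for b
  proof -
    have "\<forall>\<^sub>F j in sequentially. C * (\<epsilon> * b) \<le> M (\<phi> j) - M (Suc (\<phi> j))"
      using \<phi>_large[of K] \<phi>_near[OF \<rho>]
    proof eventually_elim
      case (elim j)
      have "\<epsilon> * b \<le> \<epsilon> * \<alpha> (\<phi> j)" using b(2) \<epsilon> by simp
      also have "\<dots> \<le> norm (s (\<phi> j))" using near1 elim by blast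
      finally have "C * (\<epsilon> * b) \<le> C * norm (s (\<phi> j))" using C by simp
      then show ?case using dec_near[OF elim(1) \<phi>(2) elim(2)] by linarith
    qed
    then have "C * (\<epsilon> * b) \<le> L - L"
      by (rule tendsto_lowerbound[OF tendsto_diff[OF M\<phi> M\<phi>']]) simp
    then show False using C \<epsilon> b by (simp add: mult_le_0_iff)
  qed
  obtain K2 where "\<alpha> K2 \<le> a" using \<alpha>_not_bounded_below[OF a] by (meson linear)
  then have K2: "\<alpha> k \<le> a" if "K2 \<le> k" for k
    using decseqD[OF alpha_decseq that] by linarith
  \<comment> \<open>The remaining merit decrease pays for a path shorter than
    \<open>\<rho> / 2\<close>, so iterates starting within \<open>\<rho> / 2\<close> of
    \<open>x_star\<close> stay within \<open>\<rho>\<close>.\<close>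
  have "\<forall>\<^sub>F j in sequentially. M (\<phi> j) < L + C * (\<rho> / 2)"
    by (rule order_tendstoD(2)[OF M\<phi>]) (use C \<rho> in simp)
  with \<phi>_large[of "max K K2"] \<phi>_near[of "\<rho> / 2"] \<rho>
  have "\<forall>\<^sub>F j in sequentially. max K K2 \<le> \<phi> j \<and> dist (x (\<phi> j)) x_star < \<rho> / 2 \<and> M (\<phi> j) < L + C * (\<rho> / 2)"
    by (simp add: eventually_conj_iff)
  then obtain N where N: "K \<le> N" "K2 \<le> N" "dist (x N) x_star < \<rho> / 2" "M N < L + C * (\<rho> / 2)"
    by (auto dest: eventually_happens)
  \<comment> \<open>The distance travelled is charged to the merit decrease. Staying near
    \<open>x_star\<close> makes the next step acceptable, which keeps \<open>\<alpha>\<close>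
    unchanged.\<close>
  have trapped: "C * dist (x k) (x N) \<le> M N - M k \<and> \<alpha> k = \<alpha> N" if "N \<le> k" for k
    using that
  proof (induction k rule: dec_induct)
    case (step k)
    have kK: "K \<le> k" "K2 \<le> k" using N step by auto
    have "C * dist (x k) (x N) < C * (\<rho> / 2)" using step M_ge[OF kK(1)] N(4) by linarith
    then have "dist (x k) (x N) < \<rho> / 2" using C by simp
    then have near: "dist (x k) x_star < \<rho>" using N(3) dist_triangle[of "x k" x_star "x N"] by linarith
    have "sufficient_decrease P f r c (x k) (\<alpha> k) T (s k)"
      using near2[OF near K2[OF kK(2)]] tau_facts(2)[OF tau_prev_pos, of k] K[OF kK(1)] by simp
    then have k: "k \<in> successful x v u" and "\<alpha> (Suc k) = \<alpha> k" "x (Suc k) = x k + s k"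
      using successful_iff alg_step(5) K[OF kK(1)] by auto
    moreover have "dist (x k + s k) (x N) \<le> dist (x k) (x N) + norm (s k)"
      using norm_triangle_ineq[of "x k - x N" "s k"] by (simp add: dist_norm algebra_simps)
    then have "C * dist (x k + s k) (x N) \<le> C * dist (x k) (x N) + C * norm (s k)"
      using C by (simp flip: distrib_left)
    ultimately show ?case using dec_near[OF kK(1) k near] step by simp
  qed simp
  have "\<alpha> N \<le> \<alpha> k" for k
    using trapped[of k] alpha_decseq by (metis decseqD linear order_refl)
  moreover have "0 < \<alpha> N" using invariant by blast
  ultimately show False using \<alpha>_not_bounded_below by blast
qed

end

theorem theorem5p25:
  fixes f r :: "real ^ 'n \<Rightarrow> real"
    and c :: "real ^ 'n \<Rightarrow> real ^ 'm"
    and P :: "'n inputs"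
    and x v u :: "nat \<Rightarrow> real ^ 'n"
    and \<alpha> \<tau> :: "nat \<Rightarrow> real"
    and X :: "(real ^ 'n) set"
    and x_star :: "real ^ 'n"
  assumes "CARD('m) \<le> CARD('n)"
    and "f differentiable_on UNIV" and "continuous_on UNIV (gradient f)"
    and "c differentiable_on UNIV" and "continuous_on UNIV (Jac c)"
    and "convex_on UNIV r" and "\<And>p. 0 \<le> r p"
    and "valid_inputs P"
    and "algorithm_run P f r c x v u \<alpha> \<tau>"
    and "\<And>k. \<not> terminates_at c x v u k"
    and "standing_assumption f r c x v X" and "bounded X"
    and "\<And>p. limit_point_along UNIV x p \<Longrightarrow> licq c p"
    and "limit_point_along (successful x v u) x x_star"
  shows "kkt_point f r c x_star"
proof -
  \<comment> \<open>The set \<open>X\<close> provides bounded iterates and a lower bound for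
    \<open>f\<close> along them.\<close>
  have X: "range x \<subseteq> X" "bounded (f ` X)" using assms(11) by (auto simp: standing_assumption_def)
  interpret run f r c P x v u \<alpha> \<tau>
    by unfold_locales (use assms X bounded_subset in auto)
  obtain F where F: "\<And>y. y \<in> X \<Longrightarrow> norm (f y) \<le> F" using X(2) by (auto simp: bounded_iff)
  have "- F \<le> f (x k)" for k
  proof -
    have "norm (f (x k)) \<le> F" using X(1) by (intro F) auto
    then show ?thesis by simp
  qed
  then show ?thesis using limit_point_kkt assms(14) by blast
qed

end
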